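(* For the Range Subgraph Listing problem with pattern $Q=$ $2\ell$-cycle where $\ell\ge 2$ is a constant, there is a data structure of $\tilde{O}(\#P_\ell)$ space answering a query with an $\tilde{O}(1)$ delay, where $\#P_\ell$ is the number of $\ell$-paths in $G$.
   Context: Range Subgraph Listing: $G=(V,E)$ is an undirected graph, each vertex $v$ carrying a real-valued attribute $A_v$. For an interval $q=[x_1,x_2]$, $G_q$ is the subgraph of $G$ induced by $\{v\in V\mid x_1\le A_v\le x_2\}$. A query, given $q$, reports all occurrences (subgraphs isomorphic to $Q$) of $Q$ in $G_q$. A $2\ell$-cycle is a cycle with $2\ell$ vertices; an $\ell$-path is a path with $\ell$ edges. A query has delay $\Delta$ if, after the previous output (with a dummy output assumed at the start), it reports a new occurrence or declares that there are no more occurrences within $\Delta$ time. $\tilde{O}(\cdot)$ hides polylogarithmic factors. *)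

theory Defs
  imports Complex_Main
begin

section \<open>Undirected graphs and occurrences of a pattern\<close>

record 'a ugraph =
  verts :: "'a set"
  edges :: "'a set set"

definition simple_graph :: "'a ugraph \<Rightarrow> bool" where
  "simple_graph G \<longleftrightarrow>
     finite (verts G) \<and> (\<forall>e\<in>edges G. e \<subseteq> verts G \<and> card e = 2)"

definition subgraph :: "'a ugraph \<Rightarrow> 'a ugraph \<Rightarrow> bool" where
  "subgraph H G \<longleftrightarrow> simple_graph H \<and> verts H \<subseteq> verts G \<and> edges H \<subseteq> edges G"

definition induced :: "'a ugraph \<Rightarrow> 'a set \<Rightarrow> 'a ugraph" where
  "induced G S = \<lparr>verts = verts G \<inter> S, edges = {e \<in> edges G. e \<subseteq> S}\<rparr>"

definition graph_image :: "('a \<Rightarrow> 'b) \<Rightarrow> 'a ugraph \<Rightarrow> 'b ugraph" where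
  "graph_image f G = \<lparr>verts = f ` verts G, edges = (\<lambda>e. f ` e) ` edges G\<rparr>"

definition isomorphic :: "'a ugraph \<Rightarrow> 'b ugraph \<Rightarrow> bool" where
  "isomorphic G H \<longleftrightarrow> (\<exists>f. inj_on f (verts G) \<and> H = graph_image f G)"

definition occurrences :: "'b ugraph \<Rightarrow> 'a ugraph \<Rightarrow> 'a ugraph set" where
  "occurrences Q G = {H. subgraph H G \<and> isomorphic Q H}"

text \<open>The cycle with \<open>m\<close> vertices (meant for \<open>m \<ge> 3\<close>) and the path with \<open>l\<close> edges.\<close>

definition cycle_graph :: "nat \<Rightarrow> nat ugraph" where
  "cycle_graph m = \<lparr>verts = {..<m}, edges = {{i, Suc i mod m} |i. i < m}\<rparr>"

definition path_graph :: "nat \<Rightarrow> nat ugraph" where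
  "path_graph l = \<lparr>verts = {..l}, edges = {{i, Suc i} |i. i < l}\<rparr>"


section \<open>A word RAM with real-valued cells\<close>

text \<open>
  Words and reals live in separate registers and separate memory arrays.  Words are \<open>w\<close>-bit
  numbers; reals can only be copied and compared, so only their relative order is observable.
  Registers (and arrays) are addressed by numbers; in \<open>Load a b\<close> and the like, the address
  is the content of a word register.
\<close>

datatype test =
    Less nat nat
  | Equal nat nat
  | RLess nat nat
  | Neg test

datatype com =
    Skip
  | Const nat nat
  | Move nat nat
  | Add nat nat nat
  | Sub nat nat nat
  | Mul nat nat nat
  | Div nat nat nat
  | Load nat nat
  | Store nat nat
  | RMove nat nat
  | RLoad nat nat
  | RStore nat nat
  | Report "nat list"
  | Seq com com
  | Cond test com com
  | While test com

record state =
  reg :: "nat \<Rightarrow> nat"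
  rreg :: "nat \<Rightarrow> real"
  mem :: "nat list"
  rmem :: "real list"

fun holds :: "test \<Rightarrow> state \<Rightarrow> bool" where
  "holds (Less a b) s \<longleftrightarrow> reg s a < reg s b"
| "holds (Equal a b) s \<longleftrightarrow> reg s a = reg s b"
| "holds (RLess a b) s \<longleftrightarrow> rreg s a < rreg s b"
| "holds (Neg t) s \<longleftrightarrow> \<not> holds t s"

definition set_reg :: "nat \<Rightarrow> nat \<Rightarrow> nat \<Rightarrow> state \<Rightarrow> state" where
  "set_reg w a x s = s\<lparr>reg := (reg s)(a := x mod 2 ^ w)\<rparr>"

definition set_rreg :: "nat \<Rightarrow> real \<Rightarrow> state \<Rightarrow> state" where
  "set_rreg a x s = s\<lparr>rreg := (rreg s)(a := x)\<rparr>"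

text \<open>
  Reading outside the allocated memory yields 0 and writing there has no effect (this is how
  \<^const>\<open>list_update\<close> behaves), so a run never uses more cells than were allocated.
\<close>

definition fetch :: "'a::zero list \<Rightarrow> nat \<Rightarrow> 'a" where
  "fetch xs i = (if i < length xs then xs ! i else 0)"

datatype event = Tick | Output "nat list"

text \<open>
  \<open>exec w c s tr s'\<close>: started in \<open>s\<close>, the program \<open>c\<close> halts in \<open>s'\<close>.  The trace \<open>tr\<close> has one
  \<^const>\<open>Tick\<close> per unit of time, interleaved with the outputs.
\<close>

inductive exec :: "nat \<Rightarrow> com \<Rightarrow> state \<Rightarrow> event list \<Rightarrow> state \<Rightarrow> bool" for w :: nat where
  Skip: "exec w Skip s [Tick] s"
| Const: "exec w (Const a k) s [Tick] (set_reg w a k s)"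
| Move: "exec w (Move a b) s [Tick] (set_reg w a (reg s b) s)"
| Add: "exec w (Add a b c) s [Tick] (set_reg w a (reg s b + reg s c) s)"
| Sub: "exec w (Sub a b c) s [Tick] (set_reg w a (reg s b - reg s c) s)"
| Mul: "exec w (Mul a b c) s [Tick] (set_reg w a (reg s b * reg s c) s)"
| Div: "exec w (Div a b c) s [Tick] (set_reg w a (reg s b div reg s c) s)"
| Load: "exec w (Load a b) s [Tick] (set_reg w a (fetch (mem s) (reg s b)) s)"
| Store: "exec w (Store a b) s [Tick] (s\<lparr>mem := (mem s)[reg s a := reg s b]\<rparr>)"
| RMove: "exec w (RMove a b) s [Tick] (set_rreg a (rreg s b) s)"
| RLoad: "exec w (RLoad a b) s [Tick] (set_rreg a (fetch (rmem s) (reg s b)) s)"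
| RStore: "exec w (RStore a b) s [Tick] (s\<lparr>rmem := (rmem s)[reg s a := rreg s b]\<rparr>)"
| Report: "exec w (Report as) s (replicate (length as) Tick @ [Output (map (reg s) as)]) s"
| Seq: "exec w c1 s tr1 s1 \<Longrightarrow> exec w c2 s1 tr2 s2 \<Longrightarrow> exec w (Seq c1 c2) s (tr1 @ tr2) s2"
| CondTrue: "holds t s \<Longrightarrow> exec w c1 s tr s' \<Longrightarrow> exec w (Cond t c1 c2) s (Tick # tr) s'"
| CondFalse: "\<not> holds t s \<Longrightarrow> exec w c2 s tr s' \<Longrightarrow> exec w (Cond t c1 c2) s (Tick # tr) s'"
| WhileFalse: "\<not> holds t s \<Longrightarrow> exec w (While t c) s [Tick] s"
| WhileTrue: "holds t s \<Longrightarrow> exec w c s tr1 s1 \<Longrightarrow> exec w (While t c) s1 tr2 s2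
    \<Longrightarrow> exec w (While t c) s (Tick # tr1 @ tr2) s2"

inductive_cases exec_elims:
  "exec w Skip s tr s'"
  "exec w (Const a k) s tr s'"
  "exec w (Move a b) s tr s'"
  "exec w (Add a b c) s tr s'"
  "exec w (Sub a b c) s tr s'"
  "exec w (Mul a b c) s tr s'"
  "exec w (Div a b c) s tr s'"
  "exec w (Load a b) s tr s'"
  "exec w (Store a b) s tr s'"
  "exec w (RMove a b) s tr s'"
  "exec w (RLoad a b) s tr s'"
  "exec w (RStore a b) s tr s'"
  "exec w (Report as) s tr s'"
  "exec w (Seq c1 c2) s tr s'"
  "exec w (Cond t c1 c2) s tr s'"
  "exec w (While t c) s tr s'"

lemma exec_deterministic:
  "exec w c s tr s' \<Longrightarrow> exec w c s tr2 s2 \<Longrightarrow> tr2 = tr \<and> s2 = s'"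
proof (induction arbitrary: tr2 s2 rule: exec.induct)
  case Seq
  from Seq.prems show ?case by (rule exec_elims) (use Seq.IH in blast)
next
  case WhileTrue
  from WhileTrue.prems show ?case
    by (rule exec_elims) (use WhileTrue.IH WhileTrue.hyps in blast)+
qed (blast elim: exec_elims)+

definition outputs :: "event list \<Rightarrow> nat list list" where
  "outputs tr = concat (map (\<lambda>e. case e of Tick \<Rightarrow> [] | Output vs \<Rightarrow> [vs]) tr)"

text \<open>
  A maximal run of ticks extends from the start or from an output to the next output or to the
  end of the execution; halting is the declaration that there are no more occurrences.
\<close>

definition has_delay :: "event list \<Rightarrow> nat \<Rightarrow> bool" where
  "has_delay tr d \<longleftrightarrow> (\<forall>xs ys zs. tr = xs @ ys @ zs \<and> set ys \<subseteq> {Tick} \<longrightarrow> length ys \<le> d)"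


section \<open>Range subgraph listing\<close>

text \<open>An input graph together with its attributes; vertices are named \<open>0, \<dots>, n - 1\<close>.\<close>

type_synonym attr_graph = "nat ugraph \<times> (nat \<Rightarrow> real)"

definition attr_graphs :: "attr_graph set" where
  "attr_graphs = {(G, A). simple_graph G \<and> verts G = {..<card (verts G)}}"

definition num_verts :: "attr_graph \<Rightarrow> nat" where
  "num_verts = (\<lambda>(G, A). card (verts G))"

definition range_graph :: "attr_graph \<Rightarrow> real \<Rightarrow> real \<Rightarrow> nat ugraph" where
  "range_graph = (\<lambda>(G, A) x1 x2. induced G {v \<in> verts G. x1 \<le> A v \<and> A v \<le> x2})"

type_synonym memory = "nat list \<times> real list"

definition memory_size :: "memory \<Rightarrow> nat" where
  "memory_size = (\<lambda>(m, r). length m + length r)"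

definition query_state :: "memory \<Rightarrow> real \<Rightarrow> real \<Rightarrow> state" where
  "query_state = (\<lambda>(m, r) x1 x2.
     \<lparr>reg = (\<lambda>_. 0), rreg = (\<lambda>_. 0)(0 := x1, 1 := x2), mem = m, rmem = r\<rparr>)"

text \<open>The memories in which a structure can be left by some sequence of completed queries.\<close>

inductive_set reachable :: "nat \<Rightarrow> com \<Rightarrow> memory \<Rightarrow> memory set"
  for w :: nat and P :: com and M0 :: memory where
  initial: "M0 \<in> reachable w P M0"
| query: "M \<in> reachable w P M0 \<Longrightarrow> exec w P (query_state M x1 x2) tr s
    \<Longrightarrow> (mem s, rmem s) \<in> reachable w P M0"

text \<open>
  For a pattern \<open>Q\<close> with vertices \<open>0, \<dots>, k - 1\<close>, an occurrence is output as a list of \<open>k\<close>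
  words, the \<open>i\<close>-th being the vertex that plays the role of \<open>i\<close>.
\<close>

definition lists_occurrences :: "nat ugraph \<Rightarrow> nat ugraph \<Rightarrow> nat list list \<Rightarrow> bool" where
  "lists_occurrences Q G vss \<longleftrightarrow>
     (\<forall>vs\<in>set vss. length vs = card (verts Q)) \<and>
     distinct (map (\<lambda>vs. graph_image (nth vs) Q) vss) \<and>
     set (map (\<lambda>vs. graph_image (nth vs) Q) vss) = occurrences Q G"

text \<open>Words have \<open>\<Theta>(log n)\<close> bits; the shift by 2 makes this meaningful for all \<open>n\<close>.\<close>

definition word_length :: "nat \<Rightarrow> attr_graph \<Rightarrow> nat" where
  "word_length c I = c * nat \<lceil>log 2 (real (num_verts I) + 2)\<rceil>"

text \<open>
  The query program \<open>P\<close> is the same for all inputs; only the memory contents \<open>build I\<close>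
  depend on the input \<open>I\<close>.
\<close>

definition range_listing_structure ::
    "nat ugraph \<Rightarrow> nat \<Rightarrow> (attr_graph \<Rightarrow> memory) \<Rightarrow> com \<Rightarrow> (attr_graph \<Rightarrow> nat) \<Rightarrow> bool" where
  "range_listing_structure Q c build P delay \<longleftrightarrow>
     (\<forall>I\<in>attr_graphs.
        (\<forall>x\<in>set (fst (build I)). x < 2 ^ word_length c I) \<and>
        (\<forall>M\<in>reachable (word_length c I) P (build I). \<forall>x1 x2.
           \<exists>tr s. exec (word_length c I) P (query_state M x1 x2) tr s \<and>
             lists_occurrences Q (range_graph I x1 x2) (outputs tr) \<and>
             has_delay tr (delay I)))"

definition soft_O :: "(attr_graph \<Rightarrow> nat) \<Rightarrow> (attr_graph \<Rightarrow> nat) \<Rightarrow> bool" where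
  "soft_O f g \<longleftrightarrow> (\<exists>C k. \<forall>I\<in>attr_graphs.
     real (f I) \<le> C * real (g I) * log 2 (real (num_verts I) + 2) ^ k)"

end

theory Submission
  imports Defs "HOL-Library.Product_Lexorder"
begin

text \<open>
  Order the vertices by attribute, ties broken by name.  A \<open>2l\<close>-cycle with least vertex \<open>u\<close> is an
  unordered pair of internally disjoint \<open>l\<close>-paths from \<open>u\<close> to the antipode \<open>v\<close> of \<open>u\<close>, and both paths
  have \<open>u\<close> as their least vertex.  The structure stores all \<open>l\<close>-paths that start at their least
  vertex, sorted by decreasing attribute of \<open>u\<close>, then by \<open>u\<close>, by \<open>v\<close> and by their greatest attribute.  A
  pair \<open>p < q\<close> of positions with the same ends lies in the range iff \<open>q\<close> does, so a query enumerates the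
  rows \<open>q\<close> in range that have some partner \<open>p < q\<close>, and for each of them all of its partners.

  Both enumerations repeatedly ask for the next row with a property.  This is binary lifting on
  a sparse table, whose entry for the block \<open>{i..<i + 2^j}\<close> holds constantly many rows of the block such
  that the property holds somewhere in the block iff it holds for one of these rows.  For the
  property of being disjoint from a given path this is a representative family: a family of \<open>a\<close>-sets
  has a subfamily of size bounded in \<open>a\<close> and \<open>b\<close> that, for every \<open>b\<close>-set disjoint from some member, contains
  a member disjoint from it.
\<close>

section \<open>Timed execution of programs without output\<close>

text \<open>The obstacle is work between two outputs that produces nothing. Whether a row
  \<open>q\<close> has a partner at all depends on the graph alone, because a partner is in range
  whenever \<open>q\<close> is; so this one bit can be stored, and the outer search never stops at a
  barren row. The inner search is harder: most earlier rows may cross \<open>q\<close>, and which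
  ones do depends on \<open>q\<close>, so lists of good partners would be too long. A representative
  family serves all \<open>q\<close> at once, and its size \<open>K\<close> depends on
  \<open>l\<close> only, since both paths have at most \<open>l - 1\<close> inner vertices. Of the
  two bounds of the range only the upper one enters the search, decided by the row of least maximum
  among those of the block that have a partner. The lower one needs no table: the attribute of the
  first vertex decreases along the rows, so the first row found below \<open>x1\<close> ends the
  query. Storing a path only in the direction that starts at its least vertex keeps the number of
  rows at most \<open>#P_l\<close>, and \<open>p < q\<close> selects one of the two orders of each
  pair.\<close>

fun straight :: "com \<Rightarrow> bool" where
  "straight (Seq c1 c2) \<longleftrightarrow> straight c1 \<and> straight c2"
| "straight (Cond t c1 c2) \<longleftrightarrow> straight c1 \<and> straight c2"
| "straight (While t c) \<longleftrightarrow> False"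
| "straight (Report rs) \<longleftrightarrow> False"
| "straight (Store a b) \<longleftrightarrow> False"
| "straight (RStore a b) \<longleftrightarrow> False"
| "straight _ \<longleftrightarrow> True"

text \<open>Loops and reports are excluded by \<open>straight\<close> so that a total function gives
  the final state and the trace consists of ticks; stores are excluded because a query never writes.
  The last equation is a default for the excluded commands.\<close>

fun sem :: "nat \<Rightarrow> com \<Rightarrow> state \<Rightarrow> state" where
  "sem w Skip s = s"
| "sem w (Const a k) s = set_reg w a k s"
| "sem w (Move a b) s = set_reg w a (reg s b) s"
| "sem w (Add a b c) s = set_reg w a (reg s b + reg s c) s"
| "sem w (Sub a b c) s = set_reg w a (reg s b - reg s c) s"
| "sem w (Mul a b c) s = set_reg w a (reg s b * reg s c) s"
| "sem w (Div a b c) s = set_reg w a (reg s b div reg s c) s"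
| "sem w (Load a b) s = set_reg w a (fetch (mem s) (reg s b)) s"
| "sem w (RMove a b) s = set_rreg a (rreg s b) s"
| "sem w (RLoad a b) s = set_rreg a (fetch (rmem s) (reg s b)) s"
| "sem w (Seq c1 c2) s = sem w c2 (sem w c1 s)"
| "sem w (Cond t c1 c2) s = (if holds t s then sem w c1 s else sem w c2 s)"
| "sem w _ s = s"

text \<open>Only an upper bound is wanted, so the two branches of a conditional are added instead of
  taking their maximum.\<close>

fun cost :: "com \<Rightarrow> nat" where
  "cost (Seq c1 c2) = cost c1 + cost c2"
| "cost (Cond t c1 c2) = Suc (cost c1 + cost c2)"
| "cost _ = 1"

fun writes :: "com \<Rightarrow> nat set" where
  "writes (Const a k) = {a}"
| "writes (Move a b) = {a}"
| "writes (Add a b c) = {a}"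
| "writes (Sub a b c) = {a}"
| "writes (Mul a b c) = {a}"
| "writes (Div a b c) = {a}"
| "writes (Load a b) = {a}"
| "writes (Seq c1 c2) = writes c1 \<union> writes c2"
| "writes (Cond t c1 c2) = writes c1 \<union> writes c2"
| "writes (While t c) = writes c"
| "writes _ = {}"

fun rwrites :: "com \<Rightarrow> nat set" where
  "rwrites (RMove a b) = {a}"
| "rwrites (RLoad a b) = {a}"
| "rwrites (Seq c1 c2) = rwrites c1 \<union> rwrites c2"
| "rwrites (Cond t c1 c2) = rwrites c1 \<union> rwrites c2"
| "rwrites (While t c) = rwrites c"
| "rwrites _ = {}"

lemma set_reg_simps [simp]:
  "reg (set_reg w a x s) = (reg s)(a := x mod 2 ^ w)"
  "rreg (set_reg w a x s) = rreg s" "mem (set_reg w a x s) = mem s" "rmem (set_reg w a x s) = rmem s"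
  "reg (set_rreg a y s) = reg s" "rreg (set_rreg a y s) = (rreg s)(a := y)"
  "mem (set_rreg a y s) = mem s" "rmem (set_rreg a y s) = rmem s"
  by (simp_all add: set_reg_def set_rreg_def)

text \<open>\<open>R\<close> collects the word registers that may change. Real registers 0 and 1
  carry the query bounds and must survive; real register 2 is scratch.\<close>

definition frame :: "nat set \<Rightarrow> state \<Rightarrow> state \<Rightarrow> bool" where
  "frame R s s' \<longleftrightarrow> mem s' = mem s \<and> rmem s' = rmem s \<and>
     (\<forall>r<2. rreg s' r = rreg s r) \<and> (\<forall>r. r \<notin> R \<longrightarrow> reg s' r = reg s r)"

lemma frame_refl [simp]: "frame R s s"
  by (simp add: frame_def)

lemma frame_trans: "frame R s s1 \<Longrightarrow> frame R s1 s2 \<Longrightarrow> frame R s s2"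
  by (simp add: frame_def)

lemma frame_mono: "frame R s s' \<Longrightarrow> R \<subseteq> R' \<Longrightarrow> frame R' s s'"
  by (auto simp: frame_def)

lemma frame_sem:
  "straight c \<Longrightarrow> writes c \<subseteq> R \<Longrightarrow> rwrites c \<subseteq> {2..} \<Longrightarrow> frame R s (sem w c s)"
proof (induction c arbitrary: s)
  case (Seq c1 c2)
  then have "frame R s (sem w c1 s)" "frame R (sem w c1 s) (sem w c2 (sem w c1 s))" by auto
  then show ?case by (auto intro: frame_trans)
qed (auto simp: frame_def)

definition runs :: "nat \<Rightarrow> com \<Rightarrow> state \<Rightarrow> nat \<Rightarrow> state \<Rightarrow> bool" where
  "runs w c s T s' \<longleftrightarrow> (\<exists>t\<le>T. exec w c s (replicate t Tick) s')"

lemma runs_mono: "runs w c s T s' \<Longrightarrow> T \<le> T' \<Longrightarrow> runs w c s T' s'"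
  by (meson le_trans runs_def)

lemma runs_Seq: "runs w c1 s T1 s1 \<Longrightarrow> runs w c2 s1 T2 s2 \<Longrightarrow> runs w (Seq c1 c2) s (T1 + T2) s2"
  unfolding runs_def by (metis add_mono exec.Seq replicate_add)

lemma runs_Skip: "runs w Skip s 1 s"
  unfolding runs_def by (rule exI[of _ 1]) (auto intro: exec.Skip)

lemma runs_Cond:
  assumes "holds t s \<Longrightarrow> runs w c1 s T s'" "\<not> holds t s \<Longrightarrow> runs w c2 s T s'"
  shows "runs w (Cond t c1 c2) s (Suc T) s'"
  using assms unfolding runs_def
  by (metis Suc_le_mono exec.CondFalse exec.CondTrue replicate_Suc)

lemma runs_WhileFalse: "\<not> holds t s \<Longrightarrow> runs w (While t c) s 1 s"
  unfolding runs_def by (rule exI[of _ 1]) (auto intro: exec.WhileFalse)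

lemma runs_WhileTrue:
  assumes "holds t s" "runs w c s T1 s1" "runs w (While t c) s1 T2 s2"
  shows "runs w (While t c) s (Suc (T1 + T2)) s2"
proof -
  obtain t1 t2 where "t1 \<le> T1" "t2 \<le> T2" "exec w c s (replicate t1 Tick) s1"
    "exec w (While t c) s1 (replicate t2 Tick) s2"
    using assms unfolding runs_def by blast
  then have "exec w (While t c) s (Tick # replicate t1 Tick @ replicate t2 Tick) s2"
    using assms(1) exec.WhileTrue by blast
  then have "exec w (While t c) s (replicate (Suc (t1 + t2)) Tick) s2"
    by (simp add: replicate_add)
  with \<open>t1 \<le> T1\<close> \<open>t2 \<le> T2\<close> show ?thesis unfolding runs_def by (intro exI[of _ "Suc (t1 + t2)"]) auto
qed

lemma runs_sem: "straight c \<Longrightarrow> runs w c s (cost c) (sem w c s)"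
proof (induction c arbitrary: s)
  case (Seq c1 c2)
  then show ?case by (auto intro: runs_Seq)
next
  case (Cond t c1 c2)
  have "runs w c1 s (cost c1 + cost c2) (sem w c1 s)" "runs w c2 s (cost c1 + cost c2) (sem w c2 s)"
    using Cond runs_mono by (metis straight.simps(2) le_add1, metis straight.simps(2) le_add2)
  then show ?case using runs_Cond[of t s w c1 "cost c1 + cost c2" "sem w (Cond t c1 c2) s" c2] by simp
qed (auto simp: runs_def numeral_eq_Suc intro!: exI[of _ "Suc 0"] exec.intros)

definition seqs :: "com list \<Rightarrow> com" where
  "seqs cs = foldr Seq cs Skip"

lemma seqs_simps [simp]: "seqs [] = Skip" "seqs (c # cs) = Seq c (seqs cs)"
  by (simp_all add: seqs_def)

lemma straight_seqs [simp]: "straight (seqs cs) \<longleftrightarrow> (\<forall>c\<in>set cs. straight c)"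
  by (induction cs) auto

lemma writes_seqs [simp]: "writes (seqs cs) = (\<Union>c\<in>set cs. writes c)"
  by (induction cs) auto

lemma rwrites_seqs [simp]: "rwrites (seqs cs) = (\<Union>c\<in>set cs. rwrites c)"
  by (induction cs) auto

section \<open>Delay of traces and of a reporting loop\<close>

lemma has_delay_replicate: "t \<le> d \<Longrightarrow> has_delay (replicate t Tick) d"
  unfolding has_delay_def by (metis le_add1 le_add2 length_append length_replicate order_trans)

text \<open>A stretch of ticks cannot contain the output, so it lies entirely before it or entirely
  after it.\<close>

lemma has_delay_Output:
  assumes "t \<le> d" "has_delay tr d"
  shows "has_delay (replicate t Tick @ Output v # tr) d"
  unfolding has_delay_def
proof (intro allI impI, elim conjE)
  fix xs ys zs
  assume eq: "replicate t Tick @ Output v # tr = xs @ ys @ zs" and ys: "set ys \<subseteq> {Tick}"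
  show "length ys \<le> d"
  proof (cases "length xs \<le> t")
    case True
    have "length (xs @ ys) \<le> t"
    proof (rule ccontr)
      assume "\<not> length (xs @ ys) \<le> t"
      then have "(xs @ ys @ zs) ! t \<in> set ys"
        using True by (auto simp: nth_append)
      moreover have "(xs @ ys @ zs) ! t = Output v"
        using arg_cong[OF eq, of "\<lambda>zs. zs ! t"] by (simp add: nth_append)
      ultimately show False using ys by auto
    qed
    then show ?thesis using assms(1) by simp
  next
    case False
    have "drop (Suc t) (xs @ ys @ zs) = tr"
      using arg_cong[OF eq, of "drop (Suc t)"] by simp
    then have "tr = drop (Suc t) xs @ ys @ zs" using False by simp
    then show ?thesis using assms(2) ys unfolding has_delay_def by blast
  qed
qed

lemma outputs_simps [simp]:
  "outputs [] = []" "outputs (Tick # tr) = outputs tr" "outputs (Output v # tr) = v # outputs tr"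
  "outputs (tr @ tr') = outputs tr @ outputs tr'" "outputs (replicate t Tick) = []"
  by (simp_all add: outputs_def)

text \<open>In the invariant \<open>I vs s\<close>, \<open>vs\<close> is the list of outputs still
  to come. The number \<open>k\<close> counts the ticks since the last output before the loop is
  entered; keeping it general lets the induction absorb the time of \<open>c2\<close>, and lets the
  caller absorb the set-up before the first output.\<close>

lemma listing_loop:
  assumes step: "\<And>v vs s. I (v # vs) s \<Longrightarrow>
      holds t s \<and> (\<exists>s1 s2. runs w c1 s T1 s1 \<and> map (reg s1) rs = v \<and> runs w c2 s1 T2 s2 \<and> I vs s2)"
    and stop: "\<And>s. I [] s \<Longrightarrow> \<not> holds t s"
    and "I vs s"
    and D: "T2 + T1 + length rs + 1 \<le> D"
  shows "\<exists>tr s'. exec w (While t (Seq c1 (Seq (Report rs) c2))) s tr s' \<and> I [] s' \<and> outputs tr = vs \<and>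
           (\<forall>k. k + T1 + length rs + 1 \<le> D \<longrightarrow> has_delay (replicate k Tick @ tr) D)"
  using \<open>I vs s\<close>
proof (induction vs arbitrary: s)
  case Nil
  have "has_delay (replicate k Tick @ [Tick]) D" if "k + T1 + length rs + 1 \<le> D" for k
    using has_delay_replicate[of "Suc k" D] that by (simp add: replicate_append_same)
  moreover have "exec w (While t (Seq c1 (Seq (Report rs) c2))) s [Tick] s"
    using stop[OF Nil] by (rule exec.WhileFalse)
  ultimately show ?case using Nil by (intro exI[of _ "[Tick]"] exI[of _ s]) auto
next
  case (Cons v vs)
  from step[OF Cons.prems] obtain s1 s2 t1 t2 where t: "holds t s"
    and "t1 \<le> T1" "exec w c1 s (replicate t1 Tick) s1" and v: "map (reg s1) rs = v"
    and "t2 \<le> T2" "exec w c2 s1 (replicate t2 Tick) s2" and I: "I vs s2"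
    unfolding runs_def by blast
  from Cons.IH[OF I] obtain tr s' where
    tr: "exec w (While t (Seq c1 (Seq (Report rs) c2))) s2 tr s'" "I [] s'" "outputs tr = vs"
      "\<And>k. k + T1 + length rs + 1 \<le> D \<Longrightarrow> has_delay (replicate k Tick @ tr) D" by blast
  let ?tr = "Tick # (replicate t1 Tick @ (replicate (length rs) Tick @ [Output (map (reg s1) rs)])
     @ replicate t2 Tick) @ tr"
  have ex: "exec w (While t (Seq c1 (Seq (Report rs) c2))) s ?tr s'"
    by (rule exec.WhileTrue[OF t exec.Seq[OF _ exec.Seq[OF exec.Report]]]) fact+
  have "has_delay (replicate k Tick @ ?tr) D" if "k + T1 + length rs + 1 \<le> D" for k
  proof -
    have eq: "replicate k Tick @ ?tr = replicate (k + Suc (t1 + length rs)) Tick @ Output v #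
            (replicate t2 Tick @ tr)"
      by (simp add: replicate_add v replicate_app_Cons_same)
    \<comment> \<open>The ticks of \<open>c2\<close> belong to the wait for the next output, so the
      induction hypothesis is used with \<open>k = t2\<close>.\<close>
    show ?thesis unfolding eq
      using that \<open>t1 \<le> T1\<close> \<open>t2 \<le> T2\<close> D by (intro has_delay_Output tr(4)) auto
  qed
  then show ?case using ex tr v by (intro exI[of _ ?tr] exI[of _ s']) simp
qed

section \<open>The query program\<close>

text \<open>
  Word registers: 0 holds 0, 1 the number \<open>N\<close> of rows, 2 the row width, 3 the number \<open>J\<close> of levels,
  4 \<open>2^J\<close>, 5 holds 1, 6 and 7 the current rows \<open>q\<close> and \<open>p\<close>, 8 a level \<open>j\<close>, 9 \<open>2^j\<close>, 10 the result of a test,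
  11 a candidate row, 12 to 16 are scratch, and 18 onwards hold the output.  Real registers 0 and 1 hold
  the query, 2 is scratch.
\<close>

definition load_field :: "nat \<Rightarrow> nat \<Rightarrow> nat \<Rightarrow> com" where
  "load_field a i k = seqs [Mul 12 i 2, Const 13 k, Add 12 12 13, Load a 12]"

text \<open>The candidates of a row begin at field \<open>7 + l\<close> and are stored level by
  level, \<open>Suc K\<close> for each; register 8 supplies the level.\<close>

definition load_cand :: "nat \<Rightarrow> nat \<Rightarrow> nat \<Rightarrow> nat \<Rightarrow> nat \<Rightarrow> com" where
  "load_cand l K a i c = seqs [Const 13 (Suc K), Mul 12 8 13, Const 13 (7 + l + c), Add 12 12 13,
     Mul 13 i 2, Add 12 12 13, Load a 12]"

text \<open>Greedy descent through the levels: the position jumps by \<open>2 ^ j\<close> when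
  register 10 reports that the block of this length contains no hit. The comparison with
  \<open>N\<close> prevents table accesses once the position has passed the end.\<close>

definition find_next :: "com \<Rightarrow> nat \<Rightarrow> com" where
  "find_next test i = Seq (seqs [Move 8 3, Move 9 4])
     (While (Less 0 8)
       (seqs [Sub 8 8 5, Const 13 2, Div 9 9 13,
          Cond (Less i 1) (seqs [test, Cond (Equal 10 0) (Add i i 9) Skip]) Skip]))"

text \<open>The array of reals holds all \<open>lo\<close> values followed by all \<open>hi\<close>
  values, hence the address \<open>N + c\<close> for a candidate \<open>c\<close>.\<close>

definition outer_test :: "nat \<Rightarrow> nat \<Rightarrow> com" where
  "outer_test l K = seqs [Const 10 0, load_cand l K 11 6 0, load_field 14 11 5,
     Cond (Less 0 14) (seqs [Add 12 1 11, RLoad 2 12, Cond (RLess 1 2) Skip (Move 10 5)]) Skip]"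

text \<open>Register 16 is a flag that \<open>inner_check\<close> sets to 1 and that any common
  vertex clears.\<close>

definition compare_vertices :: "nat \<times> nat \<Rightarrow> com" where
  "compare_vertices = (\<lambda>(a, b). seqs [load_field 14 11 (6 + a), load_field 15 6 (6 + b),
     Cond (Equal 14 15) (Move 16 0) Skip])"

definition inner_check :: "nat \<Rightarrow> nat \<Rightarrow> nat \<Rightarrow> com" where
  "inner_check l K c = seqs [load_cand l K 11 7 c, Move 16 5,
     seqs (map compare_vertices (List.product [1..<l] [1..<l])),
     Cond (Equal 16 0) Skip (Move 10 5)]"

definition inner_test :: "nat \<Rightarrow> nat \<Rightarrow> com" where
  "inner_test l K = Seq (Const 10 0) (seqs (map (inner_check l K) [1..<Suc K]))"

text \<open>The lower bound \<open>x1\<close> is examined only after a row has been found: if that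
  row violates it, so do all later ones, and setting register 6 to \<open>N\<close> ends the main
  loop.\<close>

definition next_outer :: "nat \<Rightarrow> nat \<Rightarrow> com" where
  "next_outer l K = Seq (find_next (outer_test l K) 6)
     (Cond (Less 6 1)
       (Seq (RLoad 2 6)
         (Cond (RLess 2 0) (Move 6 1) (Seq (load_field 7 6 4) (find_next (inner_test l K) 7)))) Skip)"

text \<open>The path of \<open>p\<close> is read forwards with both ends, then the path of
  \<open>q\<close> backwards without its ends.\<close>

definition load_output :: "nat \<Rightarrow> com" where
  "load_output l = seqs (map (\<lambda>k. if k \<le> l then load_field (18 + k) 7 (6 + k)
     else load_field (18 + k) 6 (6 + (2 * l - k))) [0..<2 * l])"

text \<open>The inner search is not confined to rows before \<open>q\<close>; a hit at
  \<open>q\<close> or later means that the partners of \<open>q\<close> are exhausted.\<close>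

definition advance :: "nat \<Rightarrow> nat \<Rightarrow> com" where
  "advance l K = Seq (Add 7 7 5) (Seq (find_next (inner_test l K) 7)
     (Cond (Less 7 6) Skip (Seq (Add 6 6 5) (next_outer l K))))"

definition query_setup :: com where
  "query_setup = seqs [Const 5 1, Load 1 0, Const 12 1, Load 2 12, Const 12 2, Load 3 12, Const 12 3, Load 4 12]"

definition query_prog :: "nat \<Rightarrow> nat \<Rightarrow> com" where
  "query_prog l K = Seq query_setup
     (Cond (Less 0 1)
       (Seq (next_outer l K) (While (Less 6 1)
          (Seq (load_output l) (Seq (Report [18..<18 + 2 * l]) (advance l K))))) Skip)"

text \<open>
  The first four fields are the same in all rows; the program reads them at addresses 0 to 3, so that an
  instance without rows needs no memory at all.  Candidate 0 of a block serves the search for the next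
  \<open>q\<close>, candidates 1 to \<open>K\<close> serve the search for the next \<open>p\<close>.
\<close>

definition row_width :: "nat \<Rightarrow> nat \<Rightarrow> nat \<Rightarrow> nat" where
  "row_width l K J = 7 + l + J * Suc K"

definition row_field :: "nat \<Rightarrow> nat \<Rightarrow> nat \<Rightarrow> nat \<Rightarrow> (nat \<Rightarrow> nat) \<Rightarrow> (nat \<Rightarrow> bool) \<Rightarrow> (nat \<Rightarrow> nat \<Rightarrow> nat)
    \<Rightarrow> (nat \<Rightarrow> nat \<Rightarrow> nat \<Rightarrow> nat) \<Rightarrow> nat \<Rightarrow> nat \<Rightarrow> nat" where
  "row_field l K N J start active vert cand i k =
     (if k = 0 then N else if k = 1 then row_width l K J else if k = 2 then J else if k = 3 then 2 ^ J
      else if k = 4 then start i else if k = 5 then of_bool (active i)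
      else if k \<le> 6 + l then vert i (k - 6)
      else cand i ((k - (7 + l)) div Suc K) ((k - (7 + l)) mod Suc K))"

definition rows_disjoint :: "nat \<Rightarrow> (nat \<Rightarrow> nat \<Rightarrow> nat) \<Rightarrow> nat \<Rightarrow> nat \<Rightarrow> bool" where
  "rows_disjoint l vert p q \<longleftrightarrow> (\<forall>a\<in>{1..<l}. \<forall>b\<in>{1..<l}. vert p a \<noteq> vert q b)"

section \<open>Row-major tables and the contract between table and program\<close>

definition table :: "nat \<Rightarrow> nat \<Rightarrow> (nat \<Rightarrow> nat \<Rightarrow> 'a) \<Rightarrow> 'a list" where
  "table N W f = map (\<lambda>a. f (a div W) (a mod W)) [0..<N * W]"

lemma fetch_table:
  assumes "i < N" "k < W" shows "fetch (table N W f) (i * W + k) = f i k"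
proof -
  have "i * W + k < Suc i * W" using assms by simp
  also have "\<dots> \<le> N * W" using assms by (intro mult_le_mono1) simp
  finally show ?thesis using assms by (simp add: fetch_def table_def)
qed

text \<open>Everything the program needs, stated without graphs. \<open>NJ\<close> makes the jumps
  of all levels together long enough to leave the table from any row; \<open>word_size\<close>
  prevents wrap-around of addresses and of positions after a jump; \<open>cand_outer\<close> and
  \<open>cand_inner\<close> let the candidates decide a whole block; \<open>active_iff\<close> makes
  every row found by the outer search yield an output.\<close>

locale layout =
  fixes l K N J w :: nat and start :: "nat \<Rightarrow> nat" and active :: "nat \<Rightarrow> bool"
    and vert :: "nat \<Rightarrow> nat \<Rightarrow> nat" and cand :: "nat \<Rightarrow> nat \<Rightarrow> nat \<Rightarrow> nat" and lo hi :: "nat \<Rightarrow> real"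
  assumes l2: "2 \<le> l" and N0: "0 < N" and NJ: "N < 2 ^ J"
    and word_size: "N * row_width l K J < 2 ^ w" "N + 2 ^ J < 2 ^ w"
    and vert_word: "i < N \<Longrightarrow> k \<le> l \<Longrightarrow> vert i k < 2 ^ w"
    and cand_block: "i < N \<Longrightarrow> j < J \<Longrightarrow> c \<le> K \<Longrightarrow> cand i j c \<in> {i..<i + 2 ^ j} \<inter> {..<N}"
    and cand_outer: "i < N \<Longrightarrow> j < J \<Longrightarrow> r \<in> {i..<i + 2 ^ j} \<inter> {..<N} \<Longrightarrow> active r \<Longrightarrow>
      active (cand i j 0) \<and> hi (cand i j 0) \<le> hi r"
    and cand_inner: "i < N \<Longrightarrow> j < J \<Longrightarrow> r \<in> {i..<i + 2 ^ j} \<inter> {..<N} \<Longrightarrow> q < N \<Longrightarrow> rows_disjoint l vert r q \<Longrightarrow>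
      \<exists>c\<in>{1..K}. rows_disjoint l vert (cand i j c) q"
    and lo_antimono: "i \<le> i' \<Longrightarrow> i' < N \<Longrightarrow> lo i' \<le> lo i"
    and start_le: "q < N \<Longrightarrow> start q \<le> q"
    and active_iff: "q < N \<Longrightarrow> active q \<longleftrightarrow> (\<exists>p\<in>{start q..<q}. rows_disjoint l vert p q)"
begin

abbreviation disj :: "nat \<Rightarrow> nat \<Rightarrow> bool" where "disj \<equiv> rows_disjoint l vert"

definition W :: nat where "W = row_width l K J"

definition field :: "nat \<Rightarrow> nat \<Rightarrow> nat" where "field = row_field l K N J start active vert cand"

lemmas word = word_size[folded W_def]

definition words :: "nat list" where "words = table N W field"

definition reals :: "real list" where "reals = map lo [0..<N] @ map hi [0..<N]"

lemma W_ge: "7 + l \<le> W"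
  by (simp add: W_def row_width_def)

lemma W_le: "W \<le> N * W" "N \<le> N * W"
  using N0 W_ge by simp_all

lemma W_word: "W < 2 ^ w" "k < W \<Longrightarrow> k < 2 ^ w" "i \<le> N \<Longrightarrow> i < 2 ^ w"
  using W_le word by linarith+

lemma address_word:
  assumes "i < N" "k < W" shows "i * W + k < 2 ^ w"
proof -
  have "i * W + k < Suc i * W" using assms by simp
  also have "\<dots> \<le> N * W" using assms by (intro mult_le_mono1) simp
  finally show ?thesis using word by simp
qed

lemma J_word: "J < 2 ^ w" "(2::nat) ^ J < 2 ^ w"
  using word(2) less_exp[of J] by linarith+

lemma cand_offset: "j < J \<Longrightarrow> c \<le> K \<Longrightarrow> 7 + l + (j * Suc K + c) < W"
proof -
  assume "j < J" "c \<le> K"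
  then have "j * Suc K + c < Suc j * Suc K" by simp
  also have "\<dots> \<le> J * Suc K" using \<open>j < J\<close> by (intro mult_le_mono1) simp
  finally show ?thesis by (simp add: W_def row_width_def)
qed

lemma field_eqs:
  "field i 0 = N" "field i 1 = W" "field i 2 = J" "field i 3 = 2 ^ J"
  "field i 4 = start i" "field i 5 = of_bool (active i)" 
  "k \<le> l \<Longrightarrow> field i (6 + k) = vert i k"
  "c \<le> K \<Longrightarrow> field i (7 + l + (j * Suc K + c)) = cand i j c"
  by (simp_all add: field_def row_field_def W_def div_add1_eq del: mult_Suc_right)

lemma field_word: assumes "i < N" "k < W" shows "field i k < 2 ^ w"
proof (cases "k \<le> 6 + l")
  case True
  then show ?thesis
    using assms W_word start_le[of i] vert_word[of i "k - 6"] J_word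
    by (auto simp: field_def row_field_def W_def simp del: power_strict_increasing_iff)
next
  case False
  define j c where "j = (k - (7 + l)) div Suc K" and "c = (k - (7 + l)) mod Suc K"
  have "k - (7 + l) < J * Suc K" using assms False by (simp add: W_def row_width_def)
  then have "j < J" unfolding j_def by (simp add: less_mult_imp_div_less)
  moreover have "c \<le> K" unfolding c_def using less_Suc_eq_le by fastforce
  ultimately have "cand i j c < N" using cand_block assms by force
  then show ?thesis using False W_word(3)[of "cand i j c"]
    by (simp add: field_def row_field_def j_def c_def)
qed

lemma words_word: "x \<in> set words \<Longrightarrow> x < 2 ^ w"
proof -
  assume "x \<in> set words"
  then obtain a where a: "a < N * W" "x = field (a div W) (a mod W)"
    by (auto simp: words_def table_def)
  have "a div W < N" "a mod W < W" using a(1) W_ge by (auto simp: less_mult_imp_div_less)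
  then show ?thesis using a field_word by simp
qed

lemma fetch_words: "i < N \<Longrightarrow> k < W \<Longrightarrow> fetch words (i * W + k) = field i k"
  unfolding words_def by (rule fetch_table)

lemma fetch_reals: "i < N \<Longrightarrow> fetch reals i = lo i" "i < N \<Longrightarrow> fetch reals (N + i) = hi i"
  by (simp_all add: fetch_def reals_def nth_append)

definition ready :: "real \<Rightarrow> real \<Rightarrow> state \<Rightarrow> bool" where
  "ready x1 x2 s \<longleftrightarrow> mem s = words \<and> rmem s = reals \<and> rreg s 0 = x1 \<and> rreg s 1 = x2 \<and>
     reg s 0 = 0 \<and> reg s 1 = N \<and> reg s 2 = W \<and> reg s 3 = J \<and> reg s 4 = 2 ^ J \<and> reg s 5 = 1"

lemma ready_frame: "ready x1 x2 s \<Longrightarrow> frame R s s' \<Longrightarrow> R \<subseteq> {6..} \<Longrightarrow> ready x1 x2 s'"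
proof -
  assume a: "ready x1 x2 s" "frame R s s'" "R \<subseteq> {6..}"
  have "reg s' r = reg s r" if "r < 6" for r using a(2,3) that unfolding frame_def by force
  then show ?thesis using a by (simp add: ready_def frame_def)
qed

lemma load_field:
  assumes "ready x1 x2 s" "reg s i < N" "k < W"
  shows "reg (sem w (load_field a i k) s) a = field (reg s i) k"
proof -
  have 1: "reg s i * W < 2 ^ w" using address_word[of "reg s i" 0] assms W_ge by simp
  have 2: "k < 2 ^ w" by (simp add: assms W_word)
  show ?thesis using assms 1 2 address_word[of "reg s i" k] field_word[of "reg s i" k] fetch_words
    by (simp add: load_field_def ready_def)
qed

lemma load_cand:
  assumes "ready x1 x2 s" "reg s i < N" "reg s 8 < J" "c \<le> K" "i \<notin> {12, 13}"
  shows "reg (sem w (load_cand l K a i c) s) a = cand (reg s i) (reg s 8) c"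
proof -
  let ?o = "7 + l + (reg s 8 * Suc K + c)"
  have o: "?o < W" using cand_offset assms by blast
  have 1: "reg s i * W < 2 ^ w" "reg s i * W + ?o < 2 ^ w" "?o < 2 ^ w"
    using address_word[of "reg s i" 0] address_word[of "reg s i" ?o] assms o W_word(2)[of ?o] by auto
  \<comment> \<open>\<open>Const\<close> truncates to \<open>w\<close> bits, so the factor itself
    has to fit. The level \<open>reg s 8 < J\<close> shows that \<open>J\<close> is positive, and
    then the row width exceeds \<open>Suc K\<close>.\<close>
  have 2: "Suc K < 2 ^ w"
  proof -
    have "1 * Suc K \<le> J * Suc K" using assms(3) by (intro mult_le_mono1) simp
    moreover have "J * Suc K < 2 ^ w"
      using W_word(1) unfolding W_def row_width_def by (rule le_less_trans[rotated]) simp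
    ultimately show ?thesis by (metis le_less_trans mult_1)
  qed
  have 3: "fetch words (reg s i * W + ?o) = cand (reg s i) (reg s 8) c"
    using fetch_words[OF assms(2) o] field_eqs(8)[OF assms(4)] by simp
  have 4: "cand (reg s i) (reg s 8) c < 2 ^ w"
    using field_word[OF assms(2) o] field_eqs(8)[OF assms(4)] by simp
  have 5: "reg s 8 * Suc K < 2 ^ w" "7 + l + c < 2 ^ w" "reg s 8 * Suc K + (7 + l + c) < 2 ^ w"
     "reg s 8 * Suc K + (7 + l + c) + reg s i * W < 2 ^ w"
    using 1 by linarith+
  have 6: "reg s 8 * Suc K + (7 + l + c) + reg s i * W = reg s i * W + ?o" by simp
  show ?thesis using assms 1 2 4 5 3[folded 6]
    by (simp add: load_cand_def ready_def del: mult_Suc_right)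
qed

end

lemma straight_loads [simp]: "straight (load_field a i k)" "straight (load_cand l K a i c)"
  by (simp_all add: load_field_def load_cand_def)

lemma writes_loads [simp]: "writes (load_field a i k) = {a, 12, 13}" "writes (load_cand l K a i c) = {a, 12, 13}"
  "rwrites (load_field a i k) = {}" "rwrites (load_cand l K a i c) = {}"
  by (auto simp add: load_field_def load_cand_def)

lemma compare_vertices_frame:
  "straight (compare_vertices x)" "writes (compare_vertices x) \<subseteq> {10..17}" "rwrites (compare_vertices x) \<subseteq> {2..}"
  by (auto simp: compare_vertices_def split: prod.splits)

lemma inner_check_frame:
  "straight (inner_check l K c)" "writes (inner_check l K c) \<subseteq> {10..17}" "rwrites (inner_check l K c) \<subseteq> {2..}"
  by (auto simp: inner_check_def compare_vertices_frame(1)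
      dest: compare_vertices_frame(2)[THEN subsetD] compare_vertices_frame(3)[THEN subsetD])

lemma inner_test_frame:
  "straight (inner_test l K)" "writes (inner_test l K) \<subseteq> {10..17}" "rwrites (inner_test l K) \<subseteq> {2..}"
  by (auto simp: inner_test_def inner_check_frame(1) simp del: upt_Suc
      dest: inner_check_frame(2)[THEN subsetD] inner_check_frame(3)[THEN subsetD])

lemma outer_test_frame:
  "straight (outer_test l K)" "writes (outer_test l K) \<subseteq> {10..17}" "rwrites (outer_test l K) \<subseteq> {2..}"
  by (auto simp: outer_test_def)

section \<open>Correctness of the two block tests and of binary lifting\<close>

context layout
begin

lemma frame_keeps:
  assumes "ready x1 x2 s" "frame {10..17} s s'"
  shows "ready x1 x2 s'" "reg s' 6 = reg s 6" "reg s' 7 = reg s 7" "reg s' 8 = reg s 8" "reg s' 9 = reg s 9"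
proof -
  show "ready x1 x2 s'" using assms by (rule ready_frame) auto
qed (use assms in \<open>auto simp: frame_def\<close>)

lemma small_words: "(k::nat) \<le> 7 \<Longrightarrow> k mod 2 ^ w = k"
  using W_ge W_word(1) by (intro mod_less) linarith

text \<open>If the block has an active row at all, candidate 0 is one with the least
  \<open>hi\<close>; so it passes the test exactly if some row of the block does.\<close>

lemma outer_test:
  assumes s: "ready x1 x2 s" "reg s 6 < N" "reg s 8 < J"
  shows "reg (sem w (outer_test l K) s) 10 = 0 \<longleftrightarrow>
    (\<forall>r\<in>{reg s 6..<reg s 6 + 2 ^ reg s 8} \<inter> {..<N}. \<not> (active r \<and> hi r \<le> x2))"
proof -
  define s1 s2 s3 where "s1 = sem w (Const 10 0) s" and "s2 = sem w (load_cand l K 11 6 0) s1"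
    and "s3 = sem w (load_field 14 11 5) s2"
  define c where "c = cand (reg s 6) (reg s 8) 0"
  have c: "c \<in> {reg s 6..<reg s 6 + 2 ^ reg s 8} \<inter> {..<N}"
    using cand_block s unfolding c_def by blast
  have "frame {10..17} s s1" unfolding s1_def by (rule frame_sem) auto
  note s1 = frame_keeps[OF s(1) this]
  have f2: "frame {11..17} s1 s2" unfolding s2_def by (rule frame_sem) auto
  then have "frame {10..17} s1 s2" by (rule frame_mono) auto
  note s2 = frame_keeps[OF s1(1) this]
  have f3: "frame {12..17} s2 s3" unfolding s3_def by (rule frame_sem) auto
  then have "frame {10..17} s2 s3" by (rule frame_mono) auto
  note s3 = frame_keeps[OF s2(1) this]
  have c2: "reg s2 11 = c"
    unfolding s2_def c_def using load_cand[OF s1(1), of 6 0 11] s s1 by simp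
  have "reg s3 14 = of_bool (active c)"
    unfolding s3_def using load_field[OF s2(1), of 11 5 14] c c2 W_ge field_eqs(6) by simp
  moreover have "reg s3 11 = c" "reg s3 10 = 0"
    using f3 f2 c2 by (simp_all add: frame_def s1_def)
  \<comment> \<open>The address stays below \<open>2 * N\<close>, which the width of a row (at least
    2) keeps below the bound on \<open>N * W\<close>.\<close>
  moreover have "(N + c) mod 2 ^ w = N + c"
  proof (rule mod_less)
    have "N * 2 \<le> N * W" using W_ge l2 by (intro mult_le_mono2) linarith
    moreover have "N + c < N * 2" using c by auto
    ultimately show "N + c < 2 ^ w" using word(1) by (meson le_less_trans less_le_trans order.strict_trans)
  qed
  ultimately have "reg (sem w (outer_test l K) s) 10 = of_bool (active c \<and> hi c \<le> x2)"
    using s3(1) c fetch_reals[of c] small_words[of 1]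
    by (simp add: outer_test_def s1_def[symmetric] s2_def[symmetric] s3_def[symmetric] ready_def del: sem.simps(2))
  moreover have "active c \<and> hi c \<le> x2" if "active r" "hi r \<le> x2"
     "r \<in> {reg s 6..<reg s 6 + 2 ^ reg s 8} \<inter> {..<N}" for r
    using cand_outer[OF s(2,3) that(3,1)] that(2) unfolding c_def by auto
  moreover have "P c \<longleftrightarrow> (\<exists>r\<in>B. P r)" if "c \<in> B" "\<And>r. P r \<Longrightarrow> r \<in> B \<Longrightarrow> P c" for P and B :: "nat set"
    using that by blast
  ultimately show ?thesis using c by (smt (verit, ccfv_threshold) of_bool_eq_0_iff)
qed

lemma compare_vertices:
  assumes "ready x1 x2 s" "reg s 11 < N" "reg s 6 < N" "set ps \<subseteq> {..l} \<times> {..l}"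
  shows "reg (sem w (seqs (map compare_vertices ps)) s) 16 =
     (if \<exists>(a, b)\<in>set ps. vert (reg s 11) a = vert (reg s 6) b then 0 else reg s 16)
   \<and> reg (sem w (seqs (map compare_vertices ps)) s) 10 = reg s 10"
  using assms
proof (induction ps arbitrary: s)
  case Nil
  then show ?case by simp
next
  case (Cons x ps)
  obtain a b where x: "x = (a, b)" by force
  define s1 s2 s3 where "s1 = sem w (load_field 14 11 (6 + a)) s"
    and "s2 = sem w (load_field 15 6 (6 + b)) s1" and "s3 = sem w (compare_vertices x) s"
  have ab: "a \<le> l" "b \<le> l" using Cons.prems x by auto
  then have abW: "6 + a < W" "6 + b < W" using W_ge by auto
  have f1: "frame {12, 13, 14} s s1" unfolding s1_def by (rule frame_sem) auto
  then have "frame {10..17} s s1" by (rule frame_mono) auto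
  note s1 = frame_keeps[OF Cons.prems(1) this]
  have f2: "frame {12, 13, 15} s1 s2" unfolding s2_def by (rule frame_sem) auto
  have "reg s1 14 = vert (reg s 11) a"
    unfolding s1_def using load_field[OF Cons.prems(1), of 11 "6 + a" 14] Cons.prems abW ab
    by (simp only: field_eqs)
  moreover have "reg s2 15 = vert (reg s1 6) b"
    unfolding s2_def using load_field[OF s1(1), of 6 "6 + b" 15] Cons.prems(3) s1 abW ab
    by (simp only: field_eqs)
  ultimately have s2: "reg s2 14 = vert (reg s 11) a" "reg s2 15 = vert (reg s 6) b"
    "reg s2 16 = reg s 16" "reg s2 0 = 0"
    using f1 f2 s1 Cons.prems(1) by (simp_all add: frame_def ready_def)
  have s3_eq: "s3 = (if vert (reg s 11) a = vert (reg s 6) b then set_reg w 16 0 s2 else s2)"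
    unfolding s3_def compare_vertices_def x using s2
    by (simp add: s1_def[symmetric] s2_def[symmetric])
  have f3: "frame {12..16} s s3"
    using frame_sem[OF compare_vertices_frame(1), of x "{12..16}" s w]
    by (simp add: s3_def x compare_vertices_def)
  then have "frame {10..17} s s3" by (rule frame_mono) auto
  note s3 = frame_keeps[OF Cons.prems(1) this]
  have s3': "reg s3 11 = reg s 11" "reg s3 10 = reg s 10" using f3 by (simp_all add: frame_def)
  have "reg s3 16 = (if vert (reg s 11) a = vert (reg s 6) b then 0 else reg s 16)"
    using s3_eq s2 by simp
  then show ?case
    using Cons.IH[OF s3(1)] Cons.prems s3 s3' by (auto simp: s3_def x)
qed

text \<open>Register 10 is only ever raised to 1, so a sequence of checks computes the disjunction
  over its candidates.\<close>

lemma inner_check: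
  assumes s: "ready x1 x2 s" "reg s 7 < N" "reg s 6 < N" "reg s 8 < J" and "c \<le> K"
  shows "reg (sem w (inner_check l K c) s) 10 =
    (if disj (cand (reg s 7) (reg s 8) c) (reg s 6) then 1 else reg s 10)"
proof -
  define s1 s2 s3 where "s1 = sem w (load_cand l K 11 7 c) s" and "s2 = sem w (Move 16 5) s1"
    and "s3 = sem w (seqs (map compare_vertices (List.product [1..<l] [1..<l]))) s2"
  define d where "d = cand (reg s 7) (reg s 8) c"
  have d: "d < N" using cand_block[OF s(2,4) \<open>c \<le> K\<close>] by (simp add: d_def)
  have f1: "frame {11..17} s s1" unfolding s1_def by (rule frame_sem) auto
  then have "frame {10..17} s s1" by (rule frame_mono) auto
  note s1 = frame_keeps[OF s(1) this]
  have d1: "reg s1 11 = d"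
    unfolding s1_def d_def using load_cand[OF s(1,2,4) \<open>c \<le> K\<close>] by simp
  have f2: "frame {16} s1 s2" unfolding s2_def by (rule frame_sem) auto
  then have "frame {10..17} s1 s2" by (rule frame_mono) auto
  note s2 = frame_keeps[OF s1(1) this]
  have r2: "reg s2 11 = d" "reg s2 16 = 1" "reg s2 10 = reg s 10"
    using d1 f1 s1(1) small_words[of 1] by (auto simp: s2_def frame_def ready_def)
  have "frame {10..17} s2 s3"
    unfolding s3_def by (rule frame_sem) (auto simp: compare_vertices_frame(1)
      dest: compare_vertices_frame(2)[THEN subsetD] compare_vertices_frame(3)[THEN subsetD])
  note s3 = frame_keeps[OF s2(1) this]
  have sub: "{Suc 0..<l} \<times> {Suc 0..<l} \<subseteq> {..l} \<times> {..l}" by auto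
  have "reg s3 16 = (if disj d (reg s 6) then 1 else 0) \<and> reg s3 10 = reg s 10"
    unfolding s3_def using compare_vertices[OF s2(1), of "List.product [1..<l] [1..<l]"] sub r2 s1 s2 s d
    by (simp add: rows_disjoint_def)
  moreover have "sem w (inner_check l K c) s = (if reg s3 16 = reg s3 0 then s3 else set_reg w 10 (reg s3 5) s3)"
    by (simp add: inner_check_def s1_def s2_def s3_def)
  ultimately show ?thesis using s3(1) small_words[of 1]
    unfolding d_def[symmetric] by (simp add: ready_def)
qed

lemma inner_test:
  assumes s: "ready x1 x2 s" "reg s 7 < N" "reg s 6 < N" "reg s 8 < J"
  shows "reg (sem w (inner_test l K) s) 10 = 0 \<longleftrightarrow>
    (\<forall>r\<in>{reg s 7..<reg s 7 + 2 ^ reg s 8} \<inter> {..<N}. \<not> disj r (reg s 6))"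
proof -
  have *: "reg (sem w (seqs (map (inner_check l K) cs)) s) 10 = 0 \<longleftrightarrow>
     reg s 10 = 0 \<and> (\<forall>c\<in>set cs. \<not> disj (cand (reg s 7) (reg s 8) c) (reg s 6))"
    if "ready x1 x2 s" "reg s 7 < N" "reg s 6 < N" "reg s 8 < J" "set cs \<subseteq> {..K}" for cs s
    using that
  proof (induction cs arbitrary: s)
    case Nil
    then show ?case by simp
  next
    case (Cons c cs)
    define s1 where "s1 = sem w (inner_check l K c) s"
    have "frame {10..17} s s1" unfolding s1_def using inner_check_frame by (intro frame_sem)
    note s1 = frame_keeps[OF Cons.prems(1) this]
    show ?case using Cons.IH[OF s1(1)] Cons.prems s1 inner_check[OF Cons.prems(1-4), of c]
      by (auto simp: s1_def)
  qed
  define s1 where "s1 = sem w (Const 10 0) s"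
  have "frame {10..17} s s1" unfolding s1_def by (rule frame_sem) auto
  note s1 = frame_keeps[OF s(1) this]
  have s10: "reg s1 10 = 0" by (simp add: s1_def)
  have "reg (sem w (inner_test l K) s) 10 = 0 \<longleftrightarrow>
     (\<forall>c\<in>{1..K}. \<not> disj (cand (reg s 7) (reg s 8) c) (reg s 6))"
    using *[OF s1(1), of "[1..<Suc K]"] s1 s s10
    by (simp add: inner_test_def s1_def[symmetric] atLeastLessThanSuc_atLeastAtMost subset_iff
        del: sem.simps(2) upt_Suc)
  moreover have "cand (reg s 7) (reg s 8) c \<in> {reg s 7..<reg s 7 + 2 ^ reg s 8} \<inter> {..<N}" if "c \<in> {1..K}" for c
    using cand_block s that by simp
  moreover have "\<exists>c\<in>{1..K}. disj (cand (reg s 7) (reg s 8) c) (reg s 6)"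
    if "r \<in> {reg s 7..<reg s 7 + 2 ^ reg s 8} \<inter> {..<N}" "disj r (reg s 6)" for r
    using cand_inner[OF s(2,4) that(1) s(3) that(2)] .
  ultimately show ?thesis by blast
qed

text \<open>Invariant with \<open>m\<close> levels left: no row passed so far satisfies
  \<open>\<phi>\<close>, and one of the \<open>2 ^ m\<close> positions from the current one on is a
  hit or lies beyond the table. With no level left, this position is the current one. The constant
  20 generously covers the instructions of the loop body outside the test.\<close>

lemma find_next:
  fixes i test s0
  defines "R \<equiv> insert i {8..17}"
  assumes s0: "ready x1 x2 s0" "reg s0 i \<le> N" and i: "i \<in> {6, 7}"
    and test: "straight test" "writes test \<subseteq> {10..17}" "rwrites test \<subseteq> {2..}"
    and \<phi>: "\<And>s. frame R s0 s \<Longrightarrow> reg s i < N \<Longrightarrow> reg s 8 < J \<Longrightarrow>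
      reg (sem w test s) 10 = 0 \<longleftrightarrow> (\<forall>r\<in>{reg s i..<reg s i + 2 ^ reg s 8} \<inter> {..<N}. \<not> \<phi> r)"
  shows "\<exists>s. runs w (find_next test i) s0 (4 + J * (cost test + 20)) s \<and> frame R s0 s \<and>
     reg s0 i \<le> reg s i \<and> (\<forall>r\<in>{reg s0 i..<reg s i} \<inter> {..<N}. \<not> \<phi> r) \<and> (reg s i < N \<longrightarrow> \<phi> (reg s i))"
proof -
  define body where "body = seqs [Sub 8 8 5, Const 13 2, Div 9 9 13,
          Cond (Less i 1) (seqs [test, Cond (Equal 10 0) (Add i i 9) Skip]) Skip]"
  have straight: "straight body" using test by (simp add: body_def)
  have frame_body: "frame R s (sem w body s)" for s
    using straight by (rule frame_sem) (use test in \<open>auto simp: body_def R_def\<close>)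
  have R: "R \<subseteq> {6..}" using i by (auto simp: R_def)
  have loop: "\<exists>s'. runs w (While (Less 0 8) body) s (1 + m * (cost body + 1)) s' \<and> frame R s0 s' \<and>
     reg s0 i \<le> reg s' i \<and> (\<forall>r\<in>{reg s0 i..<reg s' i} \<inter> {..<N}. \<not> \<phi> r) \<and> (reg s' i < N \<longrightarrow> \<phi> (reg s' i))"
    if "frame R s0 s" "reg s 8 = m" "m \<le> J" "reg s 9 = 2 ^ m" "reg s0 i \<le> reg s i"
      "\<forall>r\<in>{reg s0 i..<reg s i} \<inter> {..<N}. \<not> \<phi> r"
      "reg s i \<le> r" "r < reg s i + 2 ^ m" "N \<le> r \<or> \<phi> r" for m s r
    using that
  proof (induction m arbitrary: s r)
    case 0
    have "reg s 0 = 0" using ready_frame[OF s0(1) 0(1) R] by (simp add: ready_def)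
    then have "runs w (While (Less 0 8) body) s 1 s" using 0 by (intro runs_WhileFalse) simp
    moreover have "r = reg s i" using 0 by simp
    ultimately show ?case using 0 by (intro exI[of _ s]) auto
  next
    case (Suc m)
    note rdy = ready_frame[OF s0(1) Suc.prems(1) R]
    define s1 where "s1 = sem w (seqs [Sub 8 8 5, Const 13 2, Div 9 9 13]) s"
    define s2 where "s2 = sem w test s1"
    define s' where "s' = sem w body s"
    have mJ: "m < J" using Suc.prems by simp
    have pw: "(2::nat) ^ m < 2 ^ w" "2 * 2 ^ m \<le> (2::nat) ^ J"
      using power_increasing[of "Suc m" J "2::nat"] Suc.prems(3) J_word by auto
    have "m < 2 ^ w" using J_word mJ by linarith
    then have s1: "reg s1 8 = m" "reg s1 9 = 2 ^ m" "reg s1 i = reg s i" "reg s1 1 = N" "reg s1 0 = 0"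
      using rdy Suc.prems small_words[of 2] pw i by (auto simp: s1_def ready_def)
    have fs1: "frame R s s1" unfolding s1_def by (rule frame_sem) (auto simp: R_def)
    then have f1: "frame R s0 s1" using Suc.prems frame_trans by blast
    have f12: "frame {10..17} s1 s2" unfolding s2_def using test by (intro frame_sem)
    have s2: "reg s2 i = reg s i" "reg s2 9 = 2 ^ m" "reg s2 8 = m" "reg s2 0 = 0"
      using f12 s1 i by (auto simp: frame_def)
    have s'_eq: "s' = (if reg s i < N then if reg s2 10 = 0 then set_reg w i (reg s i + 2 ^ m) s2 else s2 else s1)"
      using s1 s2 unfolding s'_def body_def s1_def s2_def by simp
    have f': "frame R s0 s'" using Suc.prems(1) frame_body frame_trans unfolding s'_def by blast
    have s'8: "reg s' 8 = m" "reg s' 9 = 2 ^ m" using s1 s2 i by (auto simp: s'_eq)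
    have "\<exists>r'. reg s0 i \<le> reg s' i \<and> (\<forall>r\<in>{reg s0 i..<reg s' i} \<inter> {..<N}. \<not> \<phi> r) \<and>
        reg s' i \<le> r' \<and> r' < reg s' i + 2 ^ m \<and> (N \<le> r' \<or> \<phi> r')"
    proof (cases "reg s i < N")
      case False
      then have "reg s' i = reg s i" using s1 by (simp add: s'_eq)
      then show ?thesis using Suc.prems False by (intro exI[of _ "reg s i"]) auto
    next
      case True
      note \<phi>' = \<phi>[OF f1, folded s2_def, unfolded s1, OF True mJ]
      show ?thesis
      proof (cases "reg s2 10 = 0")
        case False
        then have "\<not> (\<forall>r\<in>{reg s i..<reg s i + 2 ^ m} \<inter> {..<N}. \<not> \<phi> r)" using \<phi>' by simp
        then obtain r' where "r' \<in> {reg s i..<reg s i + 2 ^ m} \<inter> {..<N}" "\<phi> r'" by blast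
        moreover have "reg s' i = reg s i" using s2 False True by (simp add: s'_eq)
        ultimately show ?thesis using Suc.prems by (intro exI[of _ r']) auto
      next
        case z: True
        \<comment> \<open>A jump starts below \<open>N\<close> and has length at most
          \<open>2 ^ J\<close>, so the bound on \<open>N + 2 ^ J\<close> excludes
          wrap-around.\<close>
        have "reg s i + 2 ^ m < 2 ^ w" using True word(2) pw(2) by linarith
        then have i': "reg s' i = reg s i + 2 ^ m" using z True by (simp add: s'_eq)
        have no: "\<forall>r\<in>{reg s0 i..<reg s' i} \<inter> {..<N}. \<not> \<phi> r"
          using z \<phi>' Suc.prems(6) unfolding i' by (metis IntE IntI atLeastLessThan_iff not_le)
        show ?thesis
        proof (cases "N \<le> reg s' i")
          case True
          then show ?thesis using no i' Suc.prems by (intro exI[of _ "reg s' i"]) auto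
        next
          case False
          \<comment> \<open>The old witness \<open>r\<close> survives the jump: otherwise it would
            be a row below \<open>N\<close> that satisfies \<open>\<phi>\<close> in the block just
            found free of hits.\<close>
          have "reg s' i \<le> r"
          proof (rule ccontr)
            assume "\<not> reg s' i \<le> r"
            then have "r \<in> {reg s0 i..<reg s' i} \<inter> {..<N}" using Suc.prems False by auto
            then show False using no Suc.prems(9) by auto
          qed
          then show ?thesis using no i' Suc.prems by (intro exI[of _ r]) auto
        qed
      qed
    qed
    then obtain r' where r': "reg s0 i \<le> reg s' i" "\<forall>r\<in>{reg s0 i..<reg s' i} \<inter> {..<N}. \<not> \<phi> r"
        "reg s' i \<le> r'" "r' < reg s' i + 2 ^ m" "N \<le> r' \<or> \<phi> r'" by blast
    from Suc.IH[OF f' s'8(1) less_imp_le[OF mJ] s'8(2) r'] obtain s'' where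
      s'': "runs w (While (Less 0 8) body) s' (1 + m * (cost body + 1)) s''" and
      post: "frame R s0 s''" "reg s0 i \<le> reg s'' i" "\<forall>r\<in>{reg s0 i..<reg s'' i} \<inter> {..<N}. \<not> \<phi> r"
        "reg s'' i < N \<longrightarrow> \<phi> (reg s'' i)" by blast
    have "holds (Less 0 8) s" using rdy Suc.prems(2) by (simp add: ready_def)
    from runs_WhileTrue[OF this runs_sem[OF straight, of w s, folded s'_def] s'']
    have "runs w (While (Less 0 8) body) s (1 + Suc m * (cost body + 1)) s''"
      by (rule runs_mono) simp
    then show ?case using post by blast
  qed
  define s where "s = sem w (seqs [Move 8 3, Move 9 4]) s0"
  have rs: "runs w (seqs [Move 8 3, Move 9 4]) s0 3 s"
    using runs_sem[of "seqs [Move 8 3, Move 9 4]" w s0] by (simp add: s_def numeral_3_eq_3)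
  have f: "frame R s0 s" unfolding s_def by (rule frame_sem) (auto simp: R_def)
  have s: "reg s 8 = J" "reg s 9 = 2 ^ J" "reg s i = reg s0 i"
    using s0 i J_word by (auto simp: s_def ready_def)
  \<comment> \<open>The first witness is the end of the table, which lies within
    \<open>2 ^ J\<close> positions because \<open>N < 2 ^ J\<close>.\<close>
  from loop[OF f s(1) le_refl s(2), of N] obtain s' where
    s': "runs w (While (Less 0 8) body) s (1 + J * (cost body + 1)) s'" and
    post: "frame R s0 s'" "reg s0 i \<le> reg s' i" "\<forall>r\<in>{reg s0 i..<reg s' i} \<inter> {..<N}. \<not> \<phi> r"
        "reg s' i < N \<longrightarrow> \<phi> (reg s' i)"
    using s s0(2) NJ by auto
  have "cost body + 1 \<le> cost test + 20" by (simp add: body_def)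
  then have "J * (cost body + 1) \<le> J * (cost test + 20)" by (rule mult_le_mono2)
  then have "runs w (find_next test i) s0 (4 + J * (cost test + 20)) s'"
    unfolding find_next_def body_def[symmetric] by (intro runs_mono[OF runs_Seq[OF rs s']]) simp
  then show ?thesis using post by blast
qed

end

section \<open>The enumeration loop and its delay\<close>

lemma runs_CondTrue: "holds t s \<Longrightarrow> runs w c1 s T s' \<Longrightarrow> runs w (Cond t c1 c2) s (Suc T) s'"
  by (rule runs_Cond) auto

lemma runs_CondFalse: "\<not> holds t s \<Longrightarrow> runs w c2 s T s' \<Longrightarrow> runs w (Cond t c1 c2) s (Suc T) s'"
  by (rule runs_Cond) auto

lemma filter_upt_skip:
  assumes "i \<le> k" "\<And>r. i \<le> r \<Longrightarrow> r < k \<Longrightarrow> r < M \<Longrightarrow> \<not> P r"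
  shows "filter P [i..<M] = filter P [k..<M]"
proof (cases "k \<le> M")
  case True
  then have "[i..<M] = [i..<k] @ [k..<M]" using assms(1) by (metis le_add_diff_inverse upt_add_eq_append)
  then show ?thesis using assms True by (auto simp: filter_empty_conv)
next
  case False
  then show ?thesis using assms by (auto simp: filter_empty_conv)
qed

lemma sem_seqs_append: "sem w (seqs (xs @ ys)) s = sem w (seqs ys) (sem w (seqs xs) s)"
  by (induction xs arbitrary: s) auto

definition find_time :: "nat \<Rightarrow> com \<Rightarrow> nat" where
  "find_time J test = 4 + J * (cost test + 20)"

text \<open>The worst wait between two outputs: an inner search that exhausts \<open>q\<close>, an
  outer search, an inner search for the first partner of the new row, then loading and reporting
  \<open>2 * l\<close> words. The constant 60 covers the remaining instructions, including the
  initial ones.\<close>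

definition query_delay :: "nat \<Rightarrow> nat \<Rightarrow> nat \<Rightarrow> nat" where
  "query_delay l K J = cost (load_output l) + 2 * l + 2 * find_time J (inner_test l K) +
     find_time J (outer_test l K) + 60"

context layout
begin

definition inner_pairs :: "nat \<Rightarrow> nat \<Rightarrow> (nat \<times> nat) list" where
  "inner_pairs q p = map (\<lambda>p'. (p', q)) (filter (\<lambda>p'. disj p' q) [p..<q])"

definition outer_pairs :: "real \<Rightarrow> real \<Rightarrow> nat \<Rightarrow> (nat \<times> nat) list" where
  "outer_pairs x1 x2 i = concat (map (\<lambda>q. inner_pairs q (start q))
     (filter (\<lambda>q. active q \<and> hi q \<le> x2 \<and> x1 \<le> lo q) [i..<N]))"

definition out :: "nat \<times> nat \<Rightarrow> nat list" where
  "out = (\<lambda>(p, q). map (\<lambda>k. if k \<le> l then vert p k else vert q (2 * l - k)) [0..<2 * l])"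

text \<open>Register 7 always points to a partner that has been found but not yet reported. Hence
  every iteration produces an output, and an empty \<open>vs\<close> forces \<open>q\<close> to be
  past the last row.\<close>

definition loop_inv :: "real \<Rightarrow> real \<Rightarrow> nat list list \<Rightarrow> state \<Rightarrow> bool" where
  "loop_inv x1 x2 vs s \<longleftrightarrow> ready x1 x2 s \<and>
     (let q = reg s 6; p = reg s 7 in
       q < N \<and> p < q \<and> disj p q \<and> vs = map out (inner_pairs q p @ outer_pairs x1 x2 (Suc q)) \<or>
       N \<le> q \<and> vs = [])"

lemma inner_pairs_Cons: "p < q \<Longrightarrow> disj p q \<Longrightarrow> inner_pairs q p = (p, q) # inner_pairs q (Suc p)"
  by (simp add: inner_pairs_def upt_conv_Cons)

text \<open>The search may overshoot \<open>q\<close>. The list of remaining partners is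
  nevertheless preserved, and it is empty in that case.\<close>

lemma find_inner:
  assumes s: "ready x1 x2 s" "reg s 6 < N" "reg s 7 \<le> N"
  obtains s' where "runs w (find_next (inner_test l K) 7) s (find_time J (inner_test l K)) s'"
    "ready x1 x2 s'" "reg s' 6 = reg s 6"
    "inner_pairs (reg s 6) (reg s 7) = inner_pairs (reg s 6) (reg s' 7)"
    "reg s' 7 < reg s 6 \<Longrightarrow> disj (reg s' 7) (reg s 6)"
proof -
  have "reg (sem w (inner_test l K) s1) 10 = 0 \<longleftrightarrow>
      (\<forall>r\<in>{reg s1 7..<reg s1 7 + 2 ^ reg s1 8} \<inter> {..<N}. \<not> disj r (reg s 6))"
    if f: "frame (insert 7 {8..17}) s s1" and "reg s1 7 < N" "reg s1 8 < J" for s1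
  proof -
    have "ready x1 x2 s1" using s(1) f by (rule ready_frame) auto
    moreover have "reg s1 6 = reg s 6" using f by (simp add: frame_def)
    ultimately show ?thesis using inner_test[of x1 x2 s1] that s by simp
  qed
  from find_next[OF s(1,3) _ inner_test_frame this, simplified] obtain s' where
    s': "runs w (find_next (inner_test l K) 7) s (find_time J (inner_test l K)) s'"
      "frame (insert 7 {8..17}) s s'" "reg s 7 \<le> reg s' 7"
      "\<forall>r\<in>{reg s 7..<reg s' 7} \<inter> {..<N}. \<not> disj r (reg s 6)"
      "reg s' 7 < N \<longrightarrow> disj (reg s' 7) (reg s 6)" unfolding find_time_def by auto
  show thesis
  proof (rule that)
    show "ready x1 x2 s'" using s(1) s'(2) by (rule ready_frame) auto
    show "reg s' 6 = reg s 6" using s'(2) by (simp add: frame_def)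
    show "inner_pairs (reg s 6) (reg s 7) = inner_pairs (reg s 6) (reg s' 7)"
      unfolding inner_pairs_def using s'(3,4) s(2)
      by (intro arg_cong[of _ _ "map _"] filter_upt_skip) auto
  qed (use s' s in auto)
qed

lemma outer_pairs_skip:
  assumes "i \<le> k" "\<And>r. i \<le> r \<Longrightarrow> r < k \<Longrightarrow> r < N \<Longrightarrow> \<not> (active r \<and> hi r \<le> x2)"
  shows "outer_pairs x1 x2 i = outer_pairs x1 x2 k"
  unfolding outer_pairs_def using assms by (subst filter_upt_skip[of i k]) auto

lemma next_outer:
  assumes s: "ready x1 x2 s" "reg s 6 \<le> N"
  obtains s' where "runs w (next_outer l K) s
      (find_time J (outer_test l K) + find_time J (inner_test l K) + 20) s'"
    "loop_inv x1 x2 (map out (outer_pairs x1 x2 (reg s 6))) s'"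
proof -
  let ?To = "find_time J (outer_test l K)" and ?Ti = "find_time J (inner_test l K)"
  have "reg (sem w (outer_test l K) s1) 10 = 0 \<longleftrightarrow>
      (\<forall>r\<in>{reg s1 6..<reg s1 6 + 2 ^ reg s1 8} \<inter> {..<N}. \<not> (active r \<and> hi r \<le> x2))"
    if f: "frame (insert 6 {8..17}) s s1" and "reg s1 6 < N" "reg s1 8 < J" for s1
  proof -
    have "ready x1 x2 s1" using s(1) f by (rule ready_frame) auto
    then show ?thesis using outer_test[of x1 x2 s1] that s by simp
  qed
  from find_next[OF s _ outer_test_frame this] obtain s1 where
    s1: "runs w (find_next (outer_test l K) 6) s ?To s1"
      "frame (insert 6 {8..17}) s s1" "reg s 6 \<le> reg s1 6"
      "\<forall>r\<in>{reg s 6..<reg s1 6} \<inter> {..<N}. \<not> (active r \<and> hi r \<le> x2)"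
      "reg s1 6 < N \<longrightarrow> active (reg s1 6) \<and> hi (reg s1 6) \<le> x2" unfolding find_time_def by auto
  have rdy: "ready x1 x2 s1" using s(1) s1(2) by (rule ready_frame) auto
  have skip: "outer_pairs x1 x2 (reg s 6) = outer_pairs x1 x2 (reg s1 6)"
    using s1(3,4) by (intro outer_pairs_skip) auto
  let ?c2 = "Seq (load_field 7 6 4) (find_next (inner_test l K) 7)"
  let ?c1 = "Seq (RLoad 2 6) (Cond (RLess 2 0) (Move 6 1) ?c2)"
  have "\<exists>s'. runs w (Cond (Less 6 1) ?c1 Skip) s1 (?Ti + 20) s' \<and>
     loop_inv x1 x2 (map out (outer_pairs x1 x2 (reg s1 6))) s'"
  proof (cases "reg s1 6 < N")
    case False
    then have "runs w (Cond (Less 6 1) ?c1 Skip) s1 (Suc 1) s1"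
      using rdy by (intro runs_CondFalse runs_Skip) (simp add: ready_def)
    then have "runs w (Cond (Less 6 1) ?c1 Skip) s1 (?Ti + 20) s1" by (rule runs_mono) simp
    then show ?thesis using False rdy
      by (intro exI[of _ s1]) (auto simp: loop_inv_def outer_pairs_def)
  next
    case True
    define s2 where "s2 = sem w (RLoad 2 6) s1"
    have less: "holds (Less 6 1) s1" using True rdy by (simp add: ready_def)
    have "frame {} s1 s2" unfolding s2_def by (rule frame_sem) auto
    from ready_frame[OF rdy this] have r2: "ready x1 x2 s2" by simp
    have s2: "reg s2 = reg s1" "rreg s2 2 = lo (reg s1 6)"
      using rdy fetch_reals(1)[OF True] by (auto simp: s2_def ready_def)
    have run2: "runs w (RLoad 2 6) s1 1 s2" using runs_sem[of "RLoad 2 6" w s1] by (simp add: s2_def)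
    show ?thesis
    proof (cases "lo (reg s1 6) < x1")
      case lt: True
      define s3 where "s3 = sem w (Move 6 1) s2"
      have "runs w (Move 6 1) s2 1 s3" using runs_sem[of "Move 6 1" w s2] by (simp add: s3_def)
      then have "runs w (Cond (RLess 2 0) (Move 6 1) ?c2) s2 (Suc 1) s3"
        using lt s2 r2 by (intro runs_CondTrue) (simp_all add: ready_def)
      from runs_CondTrue[OF less runs_Seq[OF run2 this]]
      have "runs w (Cond (Less 6 1) ?c1 Skip) s1 (?Ti + 20) s3" by (rule runs_mono) simp
      moreover have "frame {6} s2 s3" unfolding s3_def by (rule frame_sem) auto
      from ready_frame[OF r2 this] have "ready x1 x2 s3" by simp
      moreover have "reg s3 6 = N" using r2 W_word(3)[of N] by (simp add: s3_def ready_def)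
      \<comment> \<open>By \<open>lo_antimono\<close> every later row also starts below
        \<open>x1\<close>.\<close>
      moreover have "outer_pairs x1 x2 (reg s1 6) = []"
        using lo_antimono[of "reg s1 6"] lt by (force simp: outer_pairs_def filter_empty_conv)
      ultimately show ?thesis by (intro exI[of _ s3]) (simp add: loop_inv_def)
    next
      case ge: False
      define q where "q = reg s1 6"
      define s3 where "s3 = sem w (load_field 7 6 4) s2"
      have run3: "runs w (load_field 7 6 4) s2 5 s3"
        using runs_sem[of "load_field 7 6 4" w s2] by (simp add: s3_def load_field_def numeral_eq_Suc)
      have f3: "frame {7,12,13} s2 s3" unfolding s3_def by (rule frame_sem) auto
      from ready_frame[OF r2 this] have r3: "ready x1 x2 s3" by simp
      have "reg s3 7 = field q 4"
        unfolding s3_def using load_field[OF r2, of 6 4 7] s2 True W_ge by (simp add: q_def)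
      then have s3: "reg s3 7 = start q" "reg s3 6 = q"
        using f3 s2 by (simp_all add: frame_def q_def field_eqs)
      have q: "q < N" "active q" "hi q \<le> x2" "x1 \<le> lo q" using True s1 ge by (auto simp: q_def)
      obtain s4 where s4: "runs w (find_next (inner_test l K) 7) s3 ?Ti s4"
        "ready x1 x2 s4" "reg s4 6 = q" "inner_pairs q (start q) = inner_pairs q (reg s4 7)"
        "reg s4 7 < q \<Longrightarrow> disj (reg s4 7) q"
        by (rule find_inner[OF r3]) (use q s3 start_le[of q] in auto)
      \<comment> \<open>Here activity pays off: the inner search cannot run past \<open>q\<close>,
        so the next output is certain.\<close>
      have "inner_pairs q (start q) \<noteq> []"
        using active_iff[of q] q by (auto simp: inner_pairs_def filter_empty_conv)
      then have "reg s4 7 < q" using s4(4)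
        by (cases "reg s4 7 < q") (simp_all add: inner_pairs_def)
      moreover have "outer_pairs x1 x2 q = inner_pairs q (start q) @ outer_pairs x1 x2 (Suc q)"
        using q by (simp add: outer_pairs_def upt_conv_Cons)
      ultimately have "loop_inv x1 x2 (map out (outer_pairs x1 x2 q)) s4"
        using s4 q by (simp add: loop_inv_def)
      moreover have "runs w (Cond (RLess 2 0) (Move 6 1) ?c2) s2 (Suc (5 + ?Ti)) s4"
        using ge s2 r2 by (intro runs_CondFalse runs_Seq[OF run3 s4(1)]) (simp_all add: ready_def)
      from runs_CondTrue[OF less runs_Seq[OF run2 this]]
      have "runs w (Cond (Less 6 1) ?c1 Skip) s1 (?Ti + 20) s4" by (rule runs_mono) simp
      ultimately show ?thesis by (auto simp: q_def)
    qed
  qed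
  then obtain s' where s': "runs w (Cond (Less 6 1) ?c1 Skip) s1 (?Ti + 20) s'"
     "loop_inv x1 x2 (map out (outer_pairs x1 x2 (reg s1 6))) s'" by blast
  have "runs w (next_outer l K) s (?To + ?Ti + 20) s'"
    unfolding next_outer_def using runs_Seq[OF s1(1) s'(1)] by (simp add: add.assoc)
  then show thesis using s'(2) that skip by simp
qed

lemma load_output_frame:
  "straight (load_output l)" "writes (load_output l) \<subseteq> {8..}" "rwrites (load_output l) \<subseteq> {2..}"
  by (auto simp: load_output_def)

lemma load_output:
  assumes s: "ready x1 x2 s" "reg s 6 < N" "reg s 7 < N"
  shows "map (reg (sem w (load_output l) s)) [18..<18 + 2 * l] = out (reg s 7, reg s 6)"
proof -
  define ld where "ld = (\<lambda>k. if k \<le> l then load_field (18 + k) 7 (6 + k)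
     else load_field (18 + k) 6 (6 + (2 * l - k)))"
  have *: "reg (sem w (seqs (map ld [0..<m])) s) (18 + k) = out (reg s 7, reg s 6) ! k"
    if "m \<le> 2 * l" "k < m" for m k
    using that
  proof (induction m)
    case (Suc m)
    define s1 where "s1 = sem w (seqs (map ld [0..<m])) s"
    have "frame {8..} s s1" unfolding s1_def by (rule frame_sem) (auto simp: ld_def)
    then have s1: "ready x1 x2 s1" "reg s1 6 = reg s 6" "reg s1 7 = reg s 7"
      using ready_frame[OF s(1), of "{8..}" s1] by (auto simp: frame_def)
    have m: "6 + m < W" if "m \<le> l" for m using that W_ge by simp
    have "reg (sem w (ld m) s1) (18 + m) = (if m \<le> l then vert (reg s 7) m else vert (reg s 6) (2 * l - m))"
      using load_field[OF s1(1) _ m, of _ _ "18 + m"] s s1 field_eqs(7) by (simp add: ld_def)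
    \<comment> \<open>A load touches only its target and the scratch registers 12 and 13, so outputs
      loaded earlier are kept.\<close>
    moreover have "reg (sem w (ld m) s1) (18 + k) = reg s1 (18 + k)" if "k \<noteq> m"
    proof -
      have "frame {12, 13, 18 + m} s1 (sem w (ld m) s1)" by (rule frame_sem) (auto simp: ld_def)
      then show ?thesis using that by (simp add: frame_def)
    qed
    ultimately show ?case
      using Suc by (auto simp: sem_seqs_append s1_def[symmetric] out_def less_Suc_eq)
  qed simp
  show ?thesis
    using *[of "2 * l"] by (intro nth_equalityI) (simp_all add: out_def load_output_def ld_def)
qed

lemma advance:
  assumes s: "ready x1 x2 s" "reg s 6 < N" "reg s 7 < reg s 6"
  obtains s' where "runs w (advance l K) s
      (find_time J (outer_test l K) + 2 * find_time J (inner_test l K) + 40) s'"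
    "loop_inv x1 x2 (map out (inner_pairs (reg s 6) (Suc (reg s 7)) @ outer_pairs x1 x2 (Suc (reg s 6)))) s'"
proof -
  let ?To = "find_time J (outer_test l K)" and ?Ti = "find_time J (inner_test l K)"
  define q where "q = reg s 6"
  define s1 where "s1 = sem w (Add 7 7 5) s"
  have run1: "runs w (Add 7 7 5) s 1 s1" using runs_sem[of "Add 7 7 5" w s] by (simp add: s1_def)
  have f1: "frame {7} s s1" unfolding s1_def by (rule frame_sem) auto
  from ready_frame[OF s(1) f1] have r1: "ready x1 x2 s1" by simp
  have s1: "reg s1 6 = q" "reg s1 7 = Suc (reg s 7)"
    using s f1 W_word(3)[of "Suc (reg s 7)"] by (simp_all add: frame_def q_def s1_def ready_def)
  obtain s2 where s2: "runs w (find_next (inner_test l K) 7) s1 ?Ti s2"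
    "ready x1 x2 s2" "reg s2 6 = q" "inner_pairs q (Suc (reg s 7)) = inner_pairs q (reg s2 7)"
    "reg s2 7 < q \<Longrightarrow> disj (reg s2 7) q"
    by (rule find_inner[OF r1]) (use s s1 in \<open>auto simp: q_def\<close>)
  let ?c = "Seq (Add 6 6 5) (next_outer l K)"
  have "\<exists>s'. runs w (Cond (Less 7 6) Skip ?c) s2 (?To + ?Ti + 30) s' \<and>
      loop_inv x1 x2 (map out (inner_pairs q (Suc (reg s 7)) @ outer_pairs x1 x2 (Suc q))) s'"
  proof (cases "reg s2 7 < q")
    case True
    then have "runs w (Cond (Less 7 6) Skip ?c) s2 (Suc 1) s2"
      using s2 by (intro runs_CondTrue runs_Skip) simp
    then have "runs w (Cond (Less 7 6) Skip ?c) s2 (?To + ?Ti + 30) s2" by (rule runs_mono) simp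
    then show ?thesis using s2 True s by (intro exI[of _ s2]) (simp add: loop_inv_def q_def)
  next
    case False
    define s3 where "s3 = sem w (Add 6 6 5) s2"
    have run3: "runs w (Add 6 6 5) s2 1 s3" using runs_sem[of "Add 6 6 5" w s2] by (simp add: s3_def)
    have f3: "frame {6} s2 s3" unfolding s3_def by (rule frame_sem) auto
    from ready_frame[OF s2(2) f3] have r3: "ready x1 x2 s3" by simp
    have s3: "reg s3 6 = Suc q"
      using s s2 W_word(3)[of "Suc q"] by (simp add: q_def s3_def ready_def)
    obtain s4 where s4: "runs w (next_outer l K) s3 (?To + ?Ti + 20) s4"
      "loop_inv x1 x2 (map out (outer_pairs x1 x2 (Suc q))) s4"
      by (rule next_outer[OF r3]) (use s s3 in \<open>auto simp: q_def\<close>)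
    have "inner_pairs q (Suc (reg s 7)) = []" using False s2(4) by (simp add: inner_pairs_def)
    moreover have "runs w (Cond (Less 7 6) Skip ?c) s2 (?To + ?Ti + 30) s4"
    proof (rule runs_mono)
      show "runs w (Cond (Less 7 6) Skip ?c) s2 (Suc (1 + (?To + ?Ti + 20))) s4"
        using False s2(3) by (intro runs_CondFalse runs_Seq[OF run3 s4(1)]) simp
    qed simp
    ultimately show ?thesis using s4 by auto
  qed
  then obtain s' where s': "runs w (Cond (Less 7 6) Skip ?c) s2 (?To + ?Ti + 30) s'"
      "loop_inv x1 x2 (map out (inner_pairs q (Suc (reg s 7)) @ outer_pairs x1 x2 (Suc q))) s'" by blast
  have "runs w (advance l K) s (?To + 2 * ?Ti + 40) s'"
    unfolding advance_def by (rule runs_mono[OF runs_Seq[OF run1 runs_Seq[OF s2(1) s'(1)]]]) simp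
  then show thesis using s'(2) that unfolding q_def by blast
qed

lemma query_setup:
  "ready x1 x2 (sem w query_setup (query_state (words, reals) x1 x2))"
proof -
  have "fetch words k = field 0 k" if "k \<le> 3" for k
    using fetch_words[of 0 k] N0 W_ge that by simp
  from this[of 0] this[of 1] this[of 2] this[of 3]
  have "fetch words 0 = N" "fetch words (Suc 0) = W" "fetch words 2 = J" "fetch words 3 = 2 ^ J"
    by (simp_all add: field_eqs(1-4)[unfolded One_nat_def])
  then show ?thesis
    using small_words[of 1] small_words[of 2] small_words[of 3] W_word J_word
    by (simp add: ready_def query_setup_def query_state_def)
qed

theorem query_prog_correct:
  "\<exists>tr s. exec w (query_prog l K) (query_state (words, reals) x1 x2) tr s \<and>
     mem s = words \<and> rmem s = reals \<and> outputs tr = map out (outer_pairs x1 x2 0) \<and>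
     has_delay tr (query_delay l K J)"
proof -
  let ?To = "find_time J (outer_test l K)" and ?Ti = "find_time J (inner_test l K)"
  let ?D = "query_delay l K J"
  define s0 where "s0 = query_state (words, reals) x1 x2"
  define s1 where "s1 = sem w query_setup s0"
  have r1: "ready x1 x2 s1" unfolding s1_def s0_def by (rule query_setup)
  have "reg s1 6 = 0" by (simp add: s1_def s0_def query_setup_def query_state_def)
  then obtain s2 where s2: "runs w (next_outer l K) s1 (?To + ?Ti + 20) s2"
    "loop_inv x1 x2 (map out (outer_pairs x1 x2 0)) s2"
    using next_outer[OF r1] by auto
  have "runs w query_setup s0 9 s1"
    using runs_sem[of query_setup w s0] by (simp add: s1_def query_setup_def numeral_eq_Suc)
  then obtain t1 where t1: "t1 \<le> 9" "exec w query_setup s0 (replicate t1 Tick) s1"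
    unfolding runs_def by blast
  obtain t2 where t2: "t2 \<le> ?To + ?Ti + 20" "exec w (next_outer l K) s1 (replicate t2 Tick) s2"
    using s2(1) unfolding runs_def by blast
  let ?loop = "While (Less 6 1) (Seq (load_output l) (Seq (Report [18..<18 + 2 * l]) (advance l K)))"
  have "\<exists>tr s'. exec w ?loop s2 tr s' \<and> loop_inv x1 x2 [] s' \<and> outputs tr = map out (outer_pairs x1 x2 0) \<and>
     (\<forall>k. k + cost (load_output l) + length [18..<18 + 2 * l] + 1 \<le> ?D \<longrightarrow> has_delay (replicate k Tick @ tr) ?D)"
  proof (rule listing_loop[where ?I = "loop_inv x1 x2" and ?T2.0 = "?To + 2 * ?Ti + 40"])
    fix v vs s
    assume "loop_inv x1 x2 (v # vs) s"
    then have s: "ready x1 x2 s" "reg s 6 < N" "reg s 7 < reg s 6" "disj (reg s 7) (reg s 6)"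
      "v # vs = map out (inner_pairs (reg s 6) (reg s 7) @ outer_pairs x1 x2 (Suc (reg s 6)))"
      by (auto simp: loop_inv_def Let_def)
    define s1 where "s1 = sem w (load_output l) s"
    have "frame {8..} s s1" unfolding s1_def using load_output_frame by (rule frame_sem)
    then have s1: "ready x1 x2 s1" "reg s1 6 = reg s 6" "reg s1 7 = reg s 7"
      using ready_frame[OF s(1), of "{8..}" s1] by (auto simp: frame_def)
    obtain s2 where s2: "runs w (advance l K) s1 (?To + 2 * ?Ti + 40) s2"
      "loop_inv x1 x2 (map out (inner_pairs (reg s 6) (Suc (reg s 7)) @ outer_pairs x1 x2 (Suc (reg s 6)))) s2"
      using advance[OF s1(1)] s s1 by auto
    have "v = out (reg s 7, reg s 6)"
      "vs = map out (inner_pairs (reg s 6) (Suc (reg s 7)) @ outer_pairs x1 x2 (Suc (reg s 6)))"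
      using s(3-5) inner_pairs_Cons by simp_all
    moreover have "map (reg s1) [18..<18 + 2 * l] = out (reg s 7, reg s 6)"
      unfolding s1_def using load_output[OF s(1)] s by simp
    ultimately show "holds (Less 6 1) s \<and> (\<exists>s1 s2. runs w (load_output l) s (cost (load_output l)) s1 \<and>
        map (reg s1) [18..<18 + 2 * l] = v \<and> runs w (advance l K) s1 (?To + 2 * ?Ti + 40) s2 \<and> loop_inv x1 x2 vs s2)"
      using s s2 runs_sem[OF load_output_frame(1), of w s] by (auto simp: ready_def s1_def)
  next
    fix s
    assume "loop_inv x1 x2 [] s"
    then show "\<not> holds (Less 6 1) s"
      using inner_pairs_Cons by (auto simp: loop_inv_def Let_def ready_def)
  qed (use s2 in \<open>auto simp: query_delay_def\<close>)
  then obtain tr s3 where tr: "exec w ?loop s2 tr s3" "loop_inv x1 x2 [] s3"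
     "outputs tr = map out (outer_pairs x1 x2 0)"
     "\<And>k. k + cost (load_output l) + 2 * l + 1 \<le> ?D \<Longrightarrow> has_delay (replicate k Tick @ tr) ?D" by auto
  let ?tr = "replicate t1 Tick @ Tick # replicate t2 Tick @ tr"
  have "exec w (query_prog l K) s0 ?tr s3"
    unfolding query_prog_def using r1 N0
    by (intro exec.Seq[OF t1(2)] exec.CondTrue exec.Seq[OF t2(2) tr(1)]) (simp add: ready_def)
  moreover have "mem s3 = words" "rmem s3 = reals"
    using tr(2) by (auto simp: loop_inv_def ready_def)
  moreover have "outputs ?tr = map out (outer_pairs x1 x2 0)" using tr(3) by simp
  \<comment> \<open>Set-up and the search for the first pair count towards the first output, as if
    an output had preceded the query.\<close>
  moreover have "has_delay (replicate (t1 + Suc t2) Tick @ tr) ?D"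
    using t1 t2 by (intro tr(4)) (simp add: query_delay_def)
  then have "has_delay ?tr ?D" by (simp add: replicate_add replicate_app_Cons_same)
  ultimately show ?thesis unfolding s0_def by blast
qed

end

text \<open>In an empty memory every load yields 0, so the program reads 0 as the number of rows and
  stops.\<close>

lemma query_prog_empty:
  assumes "0 < w"
  shows "\<exists>tr s. exec w (query_prog l K) (query_state ([], []) x1 x2) tr s \<and> mem s = [] \<and> rmem s = [] \<and>
    outputs tr = [] \<and> has_delay tr (query_delay l K J)"
proof -
  define s0 where "s0 = query_state ([], []) x1 x2"
  define s1 where "s1 = sem w query_setup s0"
  have s1: "mem s1 = []" "rmem s1 = []" "reg s1 0 = 0" "reg s1 1 = 0"
    by (simp_all add: s1_def s0_def query_setup_def query_state_def fetch_def)
  have "runs w query_setup s0 9 s1"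
    using runs_sem[of query_setup w s0] by (simp add: s1_def query_setup_def numeral_eq_Suc)
  moreover have "runs w (Cond (Less 0 1) c Skip) s1 (Suc 1) s1" for c
    using s1 by (intro runs_CondFalse runs_Skip) simp
  ultimately have "runs w (query_prog l K) s0 (9 + Suc 1) s1"
    unfolding query_prog_def by (rule runs_Seq)
  then obtain t where "t \<le> 11" "exec w (query_prog l K) s0 (replicate t Tick) s1"
    unfolding runs_def by auto
  then show ?thesis using s1
    by (intro exI[of _ "replicate t Tick"] exI[of _ s1])
       (auto simp: s0_def query_delay_def intro: has_delay_replicate)
qed

section \<open>Representative families\<close>

text \<open>This is \<open>1 + a + ... + a ^ b\<close>, the number of nodes of a search tree with
  branching \<open>a\<close> and depth \<open>b\<close>. It is cruder than the binomial bound for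
  representative families but has an elementary proof.\<close>

fun rep_bound :: "nat \<Rightarrow> nat \<Rightarrow> nat" where
  "rep_bound a 0 = 1"
| "rep_bound a (Suc b) = 1 + a * rep_bound a b"

text \<open>Keep any member \<open>f\<close>. If \<open>T\<close> meets \<open>S f\<close> in some
  \<open>x\<close>, then a member disjoint from \<open>T\<close> avoids \<open>x\<close>, so it is
  enough to represent, for each of the at most \<open>a\<close> elements \<open>x\<close> of
  \<open>S f\<close>, the members avoiding \<open>x\<close> against the smaller set
  \<open>T - {x}\<close>. A representative obtained in this way avoids \<open>x\<close> as well,
  hence all of \<open>T\<close>.\<close>

lemma representative_family:
  assumes "finite F" "\<And>i. i \<in> F \<Longrightarrow> finite (S i) \<and> card (S i) \<le> a"
  shows "\<exists>R\<subseteq>F. card R \<le> rep_bound a b \<and>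
    (\<forall>T. finite T \<longrightarrow> card T \<le> b \<longrightarrow> (\<exists>f\<in>F. S f \<inter> T = {}) \<longrightarrow> (\<exists>f\<in>R. S f \<inter> T = {}))"
  using assms
proof (induction b arbitrary: F)
  case 0
  show ?case
  proof (cases "F = {}")
    case False
    then obtain f where "f \<in> F" by blast
    then show ?thesis by (intro exI[of _ "{f}"]) auto
  qed (intro exI[of _ "{}"], auto)
next
  case (Suc b)
  show ?case
  proof (cases "F = {}")
    case True
    then show ?thesis by (intro exI[of _ "{}"]) auto
  next
    case False
    then obtain f where f: "f \<in> F" by blast
    have "\<exists>R\<subseteq>{g \<in> F. x \<notin> S g}. card R \<le> rep_bound a b \<and>
      (\<forall>T. finite T \<longrightarrow> card T \<le> b \<longrightarrow> (\<exists>g\<in>{g \<in> F. x \<notin> S g}. S g \<inter> T = {}) \<longrightarrow> (\<exists>f\<in>R. S f \<inter> T = {}))" for x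
      by (rule Suc.IH) (use Suc.prems in simp_all)
    then have "\<forall>x. \<exists>R. R \<subseteq> {g \<in> F. x \<notin> S g} \<and> card R \<le> rep_bound a b \<and>
      (\<forall>T. finite T \<longrightarrow> card T \<le> b \<longrightarrow> (\<exists>g\<in>{g \<in> F. x \<notin> S g}. S g \<inter> T = {}) \<longrightarrow> (\<exists>f\<in>R. S f \<inter> T = {}))"
      by (rule allI)
    from choice[OF this] obtain R where R0: "\<forall>x. R x \<subseteq> {g \<in> F. x \<notin> S g} \<and> card (R x) \<le> rep_bound a b \<and>
      (\<forall>T. finite T \<longrightarrow> card T \<le> b \<longrightarrow> (\<exists>g\<in>{g \<in> F. x \<notin> S g}. S g \<inter> T = {}) \<longrightarrow> (\<exists>f\<in>R x. S f \<inter> T = {}))"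
      by (rule exE)
    note R = R0[THEN spec, THEN conjunct1] R0[THEN spec, THEN conjunct2, THEN conjunct1]
      R0[THEN spec, THEN conjunct2, THEN conjunct2, THEN spec, THEN mp, THEN mp, THEN mp]
    let ?R = "insert f (\<Union>x\<in>S f. R x)"
    have "card (\<Union>x\<in>S f. R x) \<le> (\<Sum>x\<in>S f. card (R x))"
      using Suc.prems(2)[OF f] by (intro card_UN_le) simp
    also have "\<dots> \<le> card (S f) * rep_bound a b"
      using R(2) sum_bounded_above[of "S f" "\<lambda>x. card (R x)"] by simp
    also have "\<dots> \<le> a * rep_bound a b" using Suc.prems(2)[OF f] by simp
    finally have "card (\<Union>x\<in>S f. R x) \<le> a * rep_bound a b" .
    moreover have "card ?R \<le> Suc (card (\<Union>x\<in>S f. R x))" by (rule card_insert_le_m1) simp_all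
    ultimately have "card ?R \<le> rep_bound a (Suc b)" by simp
    moreover have "\<exists>g\<in>?R. S g \<inter> T = {}"
      if T: "finite T" "card T \<le> Suc b" and g: "g \<in> F" "S g \<inter> T = {}" for T g
    proof (cases "S f \<inter> T = {}")
      case False
      then obtain x where x: "x \<in> S f" "x \<in> T" by blast
      have "\<exists>h\<in>R x. S h \<inter> (T - {x}) = {}"
        using T x g by (intro R(3)) auto
      then obtain h where "h \<in> R x" "S h \<inter> (T - {x}) = {}" by blast
      moreover have "x \<notin> S h" using R(1)[of x] \<open>h \<in> R x\<close> by blast
      ultimately show ?thesis using x by blast
    qed auto
    moreover have "?R \<subseteq> F" using f R(1) by blast
    ultimately show ?thesis by (intro exI[of _ ?R]) auto
  qed
qed

text \<open>The sets to be avoided are themselves of the form \<open>S q\<close>, which is why both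
  parameters of the bound are \<open>a\<close>.\<close>

lemma candidates_exist:
  fixes S :: "'i \<Rightarrow> 'a set" and hi :: "'i \<Rightarrow> 'b::linorder"
  assumes B: "finite B" "B \<noteq> {}" and S: "\<And>i. finite (S i) \<and> card (S i) \<le> a"
  shows "\<exists>f. (\<forall>c. f c \<in> B) \<and> (\<forall>r\<in>B. active r \<longrightarrow> active (f 0) \<and> hi (f 0) \<le> hi r) \<and>
    (\<forall>r\<in>B. \<forall>q. S r \<inter> S q = {} \<longrightarrow> (\<exists>c\<in>{1..rep_bound a a}. S (f c) \<inter> S q = {}))"
proof -
  have "\<exists>r0\<in>B. \<forall>r\<in>B. active r \<longrightarrow> active r0 \<and> hi r0 \<le> hi r"
  proof (cases "\<exists>r\<in>B. active r")
    case True
    define r0 where "r0 = arg_min_on hi {r \<in> B. active r}"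
    have "finite {r \<in> B. active r}" "{r \<in> B. active r} \<noteq> {}" using True B by auto
    note * = arg_min_if_finite(1)[OF this, of hi] arg_min_least[OF this, of _ hi]
    show ?thesis
      by (rule bexI[of _ r0]) (use * in \<open>auto simp: r0_def\<close>)
  next
    case False
    then show ?thesis using B by blast
  qed
  then obtain r0 where r0: "r0 \<in> B" "\<And>r. r \<in> B \<Longrightarrow> active r \<Longrightarrow> active r0 \<and> hi r0 \<le> hi r" by blast
  obtain R where R: "R \<subseteq> B" "card R \<le> rep_bound a a"
    "\<And>T. finite T \<Longrightarrow> card T \<le> a \<Longrightarrow> (\<exists>f\<in>B. S f \<inter> T = {}) \<Longrightarrow> (\<exists>f\<in>R. S f \<inter> T = {})"
    using representative_family[OF B(1), of S a a] S by blast
  have fin: "finite R" using R(1) B(1) by (rule finite_subset)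
  then obtain h where h: "bij_betw h {1..card R} R" using ex_bij_betw_nat_finite_1 by blast
  \<comment> \<open>Slots beyond the size of the family repeat \<open>r0\<close>, so that every
    candidate is a row of the block.\<close>
  define f where "f = (\<lambda>c. if c = 0 then r0 else if c \<le> card R then h c else r0)"
  have "f c \<in> B" for c
    using bij_betwE[OF h] R(1) r0(1) by (auto simp: f_def)
  moreover have "\<exists>c\<in>{1..rep_bound a a}. S (f c) \<inter> S q = {}" if q: "r \<in> B" "S r \<inter> S q = {}" for r q
  proof -
    obtain g where g: "g \<in> R" "S g \<inter> S q = {}" using R(3)[of "S q"] S q by blast
    then obtain c where "c \<in> {1..card R}" "h c = g" using h by (metis bij_betw_imp_surj_on imageE)
    then show ?thesis using g R(2) by (intro bexI[of _ c]) (auto simp: f_def)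
  qed
  moreover have "\<forall>r\<in>B. active r \<longrightarrow> active (f 0) \<and> hi (f 0) \<le> hi r" using r0 by (simp add: f_def)
  ultimately show ?thesis by blast
qed

section \<open>Cycles and paths as maps\<close>

lemma image_cycle_graph:
  "graph_image f (cycle_graph m) = \<lparr>verts = f ` {..<m}, edges = {{f i, f (Suc i mod m)} |i. i < m}\<rparr>"
  by (simp add: graph_image_def cycle_graph_def setcompr_eq_image image_image)

lemma image_path_graph:
  "graph_image f (path_graph m) = \<lparr>verts = f ` {..m}, edges = {{f i, f (Suc i)} |i. i < m}\<rparr>"
  by (simp add: graph_image_def path_graph_def setcompr_eq_image image_image)

lemma image_cycle_graph_cong:
  "(\<And>k. k < m \<Longrightarrow> f k = g k) \<Longrightarrow> graph_image f (cycle_graph m) = graph_image g (cycle_graph m)"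
proof -
  assume a: "\<And>k. k < m \<Longrightarrow> f k = g k"
  then have "f (Suc i mod m) = g (Suc i mod m)" if "i < m" for i using that by (intro a) auto
  then show ?thesis using a by (force simp: image_cycle_graph)
qed

lemma image_cycle_graph_rotate:
  fixes m r :: nat and f
  defines "g \<equiv> \<lambda>k. f ((k + r) mod m)"
  assumes "0 < m"
  shows "graph_image g (cycle_graph m) = graph_image f (cycle_graph m)"
proof -
  have eq: "{g i, g (Suc i mod m)} = {f ((i + r) mod m), f (Suc ((i + r) mod m) mod m)}" for i
    by (simp add: g_def mod_simps)
  \<comment> \<open>The preimage is \<open>j - r\<close> modulo \<open>m\<close>, with
    \<open>m\<close> added so as to stay within the natural numbers.\<close>
  have surj: "\<exists>i<m. (i + r) mod m = j" if "j < m" for j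
  proof (intro exI conjI)
    have "((j + (m - r mod m)) mod m + r) mod m = (j + (m - r mod m) + r mod m) mod m"
      by (simp only: mod_simps)
    also have "j + (m - r mod m) + r mod m = j + m"
      using mod_less_divisor[OF assms(2), of r] by linarith
    finally show "((j + (m - r mod m)) mod m + r) mod m = j" using that by simp
  qed (use assms in simp)
  have "g ` {..<m} = f ` {..<m}"
    using surj assms(2) by (auto simp: g_def image_iff)
  moreover have "{{g i, g (Suc i mod m)} |i. i < m} = {{f i, f (Suc i mod m)} |i. i < m}"
  proof (intro equalityI subsetI)
    fix e assume "e \<in> {{g i, g (Suc i mod m)} |i. i < m}"
    then obtain i where "e = {f ((i + r) mod m), f (Suc ((i + r) mod m) mod m)}" unfolding eq by blast
    then show "e \<in> {{f i, f (Suc i mod m)} |i. i < m}" using assms(2) by force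
  next
    fix e assume "e \<in> {{f i, f (Suc i mod m)} |i. i < m}"
    then obtain j where "j < m" "e = {f j, f (Suc j mod m)}" by blast
    then show "e \<in> {{g i, g (Suc i mod m)} |i. i < m}" unfolding eq using surj[of j] by blast
  qed
  ultimately show ?thesis by (simp add: image_cycle_graph)
qed

text \<open>Reflection fixes position 0 and turns edge \<open>i\<close> into edge
  \<open>m - Suc i\<close>.\<close>

lemma image_cycle_graph_reflect:
  fixes m :: nat and f
  defines "g \<equiv> \<lambda>k. f ((m - k) mod m)"
  assumes "0 < m"
  shows "graph_image g (cycle_graph m) = graph_image f (cycle_graph m)"
proof -
  have eq: "{g i, g (Suc i mod m)} = {f (m - Suc i), f (Suc (m - Suc i) mod m)}" if "i < m" for i
  proof -
    have "g (Suc i mod m) = f (m - Suc i)"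
      using that by (cases "Suc i = m") (auto simp: g_def)
    moreover have "Suc (m - Suc i) = m - i" using that by simp
    ultimately show ?thesis by (auto simp: g_def)
  qed
  have "g ` {..<m} = f ` {..<m}"
  proof (intro equalityI subsetI)
    fix y assume "y \<in> f ` {..<m}"
    then obtain k where "k < m" "y = f k" by auto
    then have "y = g ((m - k) mod m)" by (cases "k = 0") (auto simp: g_def)
    then show "y \<in> g ` {..<m}" using assms(2) by auto
  qed (use assms(2) in \<open>auto simp: g_def\<close>)
  moreover have "{{g i, g (Suc i mod m)} |i. i < m} = {{f i, f (Suc i mod m)} |i. i < m}"
  proof (intro equalityI subsetI)
    fix e assume "e \<in> {{g i, g (Suc i mod m)} |i. i < m}"
    then obtain i where "i < m" "e = {f (m - Suc i), f (Suc (m - Suc i) mod m)}" using eq by blast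
    then show "e \<in> {{f i, f (Suc i mod m)} |i. i < m}" by force
  next
    fix e assume "e \<in> {{f i, f (Suc i mod m)} |i. i < m}"
    then obtain j where j: "j < m" "e = {f j, f (Suc j mod m)}" by blast
    then have "m - Suc j < m" "m - Suc (m - Suc j) = j" by auto
    then have "e = {g (m - Suc j), g (Suc (m - Suc j) mod m)}" using eq j by metis
    then show "e \<in> {{g i, g (Suc i mod m)} |i. i < m}" using \<open>m - Suc j < m\<close> by blast
  qed
  ultimately show ?thesis by (simp add: image_cycle_graph)
qed

text \<open>Cycles are handled as maps on positions because a path pair gives such a map directly.
  One subgraph has several maps; \<open>cycle_unique\<close> shows that fixing the vertex at
  position 0 leaves only a reflection.\<close>

definition cycle_in :: "nat \<Rightarrow> (nat \<Rightarrow> 'a) \<Rightarrow> 'a ugraph \<Rightarrow> bool" where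
  "cycle_in m f G \<longleftrightarrow> inj_on f {..<m} \<and> f ` {..<m} \<subseteq> verts G \<and> (\<forall>i<m. {f i, f (Suc i mod m)} \<in> edges G)"

lemma cycle_in_iff:
  "cycle_in m f G \<longleftrightarrow> inj_on f {..<m} \<and> verts (graph_image f (cycle_graph m)) \<subseteq> verts G \<and>
     edges (graph_image f (cycle_graph m)) \<subseteq> edges G"
  by (auto simp: cycle_in_def image_cycle_graph)

lemma cycle_in_rotate:
  assumes "0 < m" "cycle_in m f G" shows "cycle_in m (\<lambda>k. f ((k + r) mod m)) G"
proof -
  have "inj_on f {..<m}" using assms by (simp add: cycle_in_def)
  moreover have "inj_on (\<lambda>k. (k + r) mod m) {..<m}"
  proof (rule linorder_inj_onI)
    fix a b assume "a < b" "a \<in> {..<m}" "b \<in> {..<m}"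
    then have "\<not> m dvd (b + r) - (a + r)" by (auto dest: dvd_imp_le)
    then show "(a + r) mod m \<noteq> (b + r) mod m"
      using \<open>a < b\<close> mod_eq_dvd_iff_nat[of "a + r" "b + r" m] by simp
  qed auto
  ultimately have "inj_on (\<lambda>k. f ((k + r) mod m)) {..<m}"
  proof (intro inj_onI)
    fix a b assume ab: "a \<in> {..<m}" "b \<in> {..<m}" "f ((a + r) mod m) = f ((b + r) mod m)"
    then have "(a + r) mod m = (b + r) mod m"
      using inj_onD[OF \<open>inj_on f {..<m}\<close> ab(3)] assms(1) by simp
    then show "a = b"
      by (rule inj_onD[OF \<open>inj_on (\<lambda>k. (k + r) mod m) {..<m}\<close>]) (use ab in simp_all)
  qed
  then show ?thesis using assms
    unfolding cycle_in_iff image_cycle_graph_rotate[OF assms(1)] by blast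
qed

lemma reflect_reflect: "k < m \<Longrightarrow> (m - (m - k) mod m) mod m = (k::nat)"
  by (cases "k = 0") auto

lemma inj_on_reflect:
  fixes m :: nat
  assumes "inj_on f {..<m}" shows "inj_on (\<lambda>k. f ((m - k) mod m)) {..<m}"
proof (rule inj_onI)
  fix a b assume ab: "a \<in> {..<m}" "b \<in> {..<m}" "f ((m - a) mod m) = f ((m - b) mod m)"
  then have "(m - a) mod m = (m - b) mod m" using inj_onD[OF assms] by auto
  then have "(m - (m - a) mod m) mod m = (m - (m - b) mod m) mod m" by simp
  then show "a = b" using ab reflect_reflect by simp
qed

lemma cycle_in_reflect:
  assumes "0 < m" "cycle_in m f G" shows "cycle_in m (\<lambda>k. f ((m - k) mod m)) G"
proof -
  have "inj_on f {..<m}" using assms by (simp add: cycle_in_def)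
  then show ?thesis using assms inj_on_reflect
    unfolding cycle_in_iff image_cycle_graph_reflect[OF assms(1)] by blast
qed

lemma cycle_occurrences:
  assumes "2 \<le> m"
  shows "occurrences (cycle_graph m) G = {graph_image f (cycle_graph m) |f. cycle_in m f G}"
proof -
  have "simple_graph (graph_image f (cycle_graph m))" if "inj_on f {..<m}" for f :: "nat \<Rightarrow> 'a"
  proof -
    have "f i \<noteq> f (Suc i mod m)" if "i < m" for i
    proof
      assume "f i = f (Suc i mod m)"
      then have "i = Suc i mod m" using \<open>inj_on f {..<m}\<close> that assms by (auto dest: inj_onD)
      then show False using that assms by (cases "Suc i = m") auto
    qed
    then show ?thesis using assms by (auto simp: simple_graph_def image_cycle_graph)
  qed
  then show ?thesis
    by (auto simp: occurrences_def subgraph_def isomorphic_def cycle_in_iff) (auto simp: cycle_graph_def)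
qed

text \<open>A walk along the cycle cannot turn back: of the two edges at the vertex in position
  \<open>k - 1\<close>, one leads to the vertex in position \<open>k - 2\<close>, which injectivity
  of \<open>f\<close> excludes, and the other to \<open>g k\<close>.\<close>

lemma cycle_determined:
  assumes m: "3 \<le> m" and f: "inj_on f {..<m}" and g: "inj_on g {..<m}"
    and eq: "edges (graph_image f (cycle_graph m)) = edges (graph_image g (cycle_graph m))"
    and start: "f 0 = g 0" "f 1 = g 1"
  shows "k < m \<Longrightarrow> f k = g k"
proof (induction k rule: less_induct)
  case (less k)
  show ?case
  proof (cases "k \<le> 1")
    case True
    then show ?thesis using start by (cases k) auto
  next
    case False
    then obtain j where k: "k = Suc (Suc j)" by (metis Suc_le_D not_less_eq_eq One_nat_def)
    have IH: "f j = g j" "f (Suc j) = g (Suc j)" using less k by auto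
    have "{f (Suc j), f k} \<in> edges (graph_image f (cycle_graph m))"
      using less.prems k by (auto simp: image_cycle_graph intro!: exI[of _ "Suc j"])
    then obtain i where i: "i < m" "{f (Suc j), f k} = {g i, g (Suc i mod m)}"
      unfolding eq by (auto simp: image_cycle_graph)
    have ne: "f k \<noteq> f j" using f less.prems k by (auto dest: inj_onD)
    show ?thesis
    proof (cases "g i = g (Suc j)")
      case True
      then have "i = Suc j" using g i less.prems k by (auto dest: inj_onD)
      then show ?thesis using i IH k less.prems by (auto simp: doubleton_eq_iff)
    next
      case False
      then have *: "g (Suc i mod m) = g (Suc j)" "f k = g i" using i IH by (auto simp: doubleton_eq_iff)
      have "Suc i mod m = Suc j" using inj_onD[OF g *(1)] i less.prems k by auto
      then have "i = j" using i(1) by (cases "Suc i = m") auto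
      then show ?thesis using * ne IH by simp
    qed
  qed
qed

text \<open>The neighbours of \<open>g 0\<close> are \<open>g 1\<close> and
  \<open>g (m - 1)\<close>, and \<open>f 1\<close> is one of them. In the second case the reflection
  of \<open>g\<close> agrees with \<open>f\<close> on the first two positions.\<close>

lemma cycle_unique:
  assumes m: "3 \<le> m" and f: "inj_on f {..<m}" and g: "inj_on g {..<m}"
    and eq: "graph_image f (cycle_graph m) = graph_image g (cycle_graph m)"
    and start: "f 0 = g 0"
  shows "(\<forall>k<m. f k = g k) \<or> (\<forall>k<m. f k = g ((m - k) mod m))"
proof -
  have "{f 0, f 1} \<in> edges (graph_image f (cycle_graph m))"
    using m by (auto simp: image_cycle_graph intro!: exI[of _ 0])
  then obtain i where i: "i < m" "{f 0, f 1} = {g i, g (Suc i mod m)}"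
    unfolding eq by (auto simp: image_cycle_graph)
  show ?thesis
  proof (cases "g i = g 0")
    case True
    then have "i = 0" using g i m by (auto dest: inj_onD)
    then have "f 1 = g 1" using i start m by (auto simp: doubleton_eq_iff)
    then show ?thesis using cycle_determined[OF m f g] eq start by auto
  next
    case False
    then have *: "g (Suc i mod m) = g 0" "f 1 = g i" using i start by (auto simp: doubleton_eq_iff)
    have "Suc i mod m = 0" using inj_onD[OF g *(1)] i m by auto
    then have "i = m - 1" using i(1) by (cases "Suc i = m") auto
    define h where "h = (\<lambda>k. g ((m - k) mod m))"
    have "inj_on h {..<m}" unfolding h_def using g by (rule inj_on_reflect)
    moreover have "f 0 = h 0" "f 1 = h 1" using start * \<open>i = m - 1\<close> m by (auto simp: h_def)
    moreover have "graph_image h (cycle_graph m) = graph_image g (cycle_graph m)"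
      unfolding h_def using m by (intro image_cycle_graph_reflect) simp
    ultimately show ?thesis using cycle_determined[OF m f, of h] eq by (auto simp: h_def)
  qed
qed

text \<open>In contrast to a cycle, the start alone suffices, since an end of a path has a single
  neighbour; from there on a backward step would repeat a vertex.\<close>

lemma path_determined:
  assumes f: "inj_on f {..m}" and g: "inj_on g {..m}"
    and eq: "edges (graph_image f (path_graph m)) = edges (graph_image g (path_graph m))"
    and start: "f 0 = g 0"
  shows "k \<le> m \<Longrightarrow> f k = g k"
proof (induction k rule: less_induct)
  case (less k)
  show ?case
  proof (cases k)
    case 0
    then show ?thesis using start by simp
  next
    case (Suc j)
    have IH: "f j = g j" using less Suc by auto
    have "{f j, f k} \<in> edges (graph_image f (path_graph m))"
      using less.prems Suc by (auto simp: image_path_graph)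
    then obtain i where i: "i < m" "{f j, f k} = {g i, g (Suc i)}"
      unfolding eq by (auto simp: image_path_graph)
    show ?thesis
    proof (cases "g i = g j")
      case True
      then have "i = j" using g i less.prems Suc by (auto dest: inj_onD)
      then show ?thesis using i IH Suc by (auto simp: doubleton_eq_iff)
    next
      case False
      then have *: "g (Suc i) = g j" "f k = g i" using i IH by (auto simp: doubleton_eq_iff)
      have j: "Suc i = j" using inj_onD[OF g *(1)] i less.prems Suc by auto
      then have "f i = g i" using less Suc by auto
      then have "k = i" using * inj_onD[OF f, of k i] less.prems i by auto
      then show ?thesis using j Suc by simp
    qed
  qed
qed

lemma finite_occurrences:
  assumes "simple_graph G" shows "finite (occurrences Q G)"
proof -
  have "edges G \<subseteq> Pow (verts G)" using assms by (auto simp: simple_graph_def)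
  then have "finite (edges G)" by (rule finite_subset) (use assms in \<open>simp add: simple_graph_def\<close>)
  then have "finite (Pow (verts G) \<times> Pow (edges G))"
    using assms by (simp add: simple_graph_def)
  moreover have "occurrences Q G \<subseteq> (\<lambda>(V, E). \<lparr>verts = V, edges = E\<rparr>) ` (Pow (verts G) \<times> Pow (edges G))"
  proof
    fix H assume "H \<in> occurrences Q G"
    then have "(verts H, edges H) \<in> Pow (verts G) \<times> Pow (edges G)"
      by (auto simp: occurrences_def subgraph_def)
    then show "H \<in> (\<lambda>(V, E). \<lparr>verts = V, edges = E\<rparr>) ` (Pow (verts G) \<times> Pow (edges G))"
      by (rule rev_image_eqI) simp
  qed
  ultimately show ?thesis using finite_subset by blast
qed

section \<open>Cycles as pairs of paths from the least vertex\<close>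

lemma distinct_concat_map:
  assumes "distinct xs" "\<And>x. x \<in> set xs \<Longrightarrow> distinct (f x)"
    "\<And>x y. x \<in> set xs \<Longrightarrow> y \<in> set xs \<Longrightarrow> x \<noteq> y \<Longrightarrow> set (f x) \<inter> set (f y) = {}"
  shows "distinct (concat (map f xs))"
  using assms
proof (induction xs)
  case (Cons x xs)
  have "set (f x) \<inter> set (concat (map f xs)) = {}"
    using Cons.prems by fastforce
  then show ?case using Cons by simp
qed simp

locale input_graph =
  fixes l :: nat and G :: "nat ugraph" and A :: "nat \<Rightarrow> real"
  assumes l2: "2 \<le> l" and simple: "simple_graph G"
begin

definition precedes :: "nat \<Rightarrow> nat \<Rightarrow> bool" where
  "precedes u v \<longleftrightarrow> A u < A v \<or> A u = A v \<and> u \<le> v"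

definition min_paths :: "nat list set" where
  "min_paths = {vs. length vs = Suc l \<and> distinct vs \<and> set vs \<subseteq> verts G \<and>
     (\<forall>i<l. {vs ! i, vs ! Suc i} \<in> edges G) \<and> (\<forall>v\<in>set vs. precedes (vs ! 0) v)}"

text \<open>The first component makes \<open>lo\<close> decrease along the table, the first three
  make rows with equal ends consecutive, and the last makes \<open>hi\<close> increase within such a
  group.\<close>

definition key :: "nat list \<Rightarrow> real \<times> nat \<times> nat \<times> real" where
  "key vs = (- A (vs ! 0), vs ! 0, vs ! l, Max (A ` set vs))"

definition paths :: "nat list list" where
  "paths = sort_key key (SOME xs. set xs = min_paths \<and> distinct xs)"

definition N :: nat where "N = length paths"

definition J :: nat where "J = (LEAST j. N < 2 ^ j)"

definition K :: nat where "K = rep_bound (l - 1) (l - 1)"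

definition vert :: "nat \<Rightarrow> nat \<Rightarrow> nat" where "vert i k = paths ! i ! k"

definition lo :: "nat \<Rightarrow> real" where "lo i = A (vert i 0)"

definition hi :: "nat \<Rightarrow> real" where "hi i = Max (A ` set (paths ! i))"

definition inner :: "nat \<Rightarrow> nat set" where "inner i = vert i ` {1..<l}"

definition same_ends :: "nat \<Rightarrow> nat \<Rightarrow> bool" where
  "same_ends p q \<longleftrightarrow> vert p 0 = vert q 0 \<and> vert p l = vert q l"

definition start :: "nat \<Rightarrow> nat" where "start q = (LEAST p. same_ends p q)"

text \<open>No query bound occurs here: by \<open>hi_mono\<close> a partner before \<open>q\<close>
  stays within any upper bound that \<open>q\<close> respects, and it has the same least vertex. So
  activity can be stored with the row.\<close>

definition active :: "nat \<Rightarrow> bool" where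
  "active q \<longleftrightarrow> (\<exists>p\<in>{start q..<q}. inner p \<inter> inner q = {})"

definition block :: "nat \<Rightarrow> nat \<Rightarrow> nat set" where "block i j = {i..<i + 2 ^ j} \<inter> {..<N}"

definition cand :: "nat \<Rightarrow> nat \<Rightarrow> nat \<Rightarrow> nat" where
  "cand i j = (SOME f. (\<forall>c. f c \<in> block i j) \<and>
     (\<forall>r\<in>block i j. active r \<longrightarrow> active (f 0) \<and> hi (f 0) \<le> hi r) \<and>
     (\<forall>r\<in>block i j. \<forall>q. inner r \<inter> inner q = {} \<longrightarrow> (\<exists>c\<in>{1..K}. inner (f c) \<inter> inner q = {})))"

section \<open>The vertex order and the sorted table of paths\<close>

lemma precedes_simps: "precedes u u" "precedes u v \<Longrightarrow> precedes v u \<Longrightarrow> u = v" "precedes u v \<Longrightarrow> A u \<le> A v"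
  by (auto simp: precedes_def)

lemma precedes_total: "precedes u v \<or> precedes v u"
  by (auto simp: precedes_def)

lemma precedes_trans: "precedes u v \<Longrightarrow> precedes v x \<Longrightarrow> precedes u x"
  by (auto simp: precedes_def)

lemma precedes_least: "finite S \<Longrightarrow> S \<noteq> {} \<Longrightarrow> \<exists>u\<in>S. \<forall>v\<in>S. precedes u v"
proof (induction S rule: finite_ne_induct)
  case (insert x F)
  then obtain u where "u \<in> F" "\<forall>v\<in>F. precedes u v" by blast
  then show ?case using precedes_total[of u x] precedes_trans precedes_simps(1) by (metis insert_iff)
qed (simp add: precedes_simps)

lemma finite_verts: "finite (verts G)"
  using simple by (simp add: simple_graph_def)

lemma min_paths_lists: "min_paths \<subseteq> {vs. set vs \<subseteq> verts G \<and> length vs = Suc l}"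
  by (auto simp: min_paths_def)

lemma finite_min_paths: "finite min_paths"
  using finite_lists_length_eq[OF finite_verts] min_paths_lists finite_subset by blast

lemma paths: "set paths = min_paths" "distinct paths"
  and sorted_paths: "sorted (map key paths)"
proof -
  have "\<exists>xs. set xs = min_paths \<and> distinct xs" using finite_distinct_list[OF finite_min_paths] by blast
  from someI_ex[OF this] show "set paths = min_paths" "distinct paths"
    by (simp_all add: paths_def)
  show "sorted (map key paths)" by (simp add: paths_def)
qed

lemma N_card: "N = card min_paths"
  using paths distinct_card[of paths] by (simp add: N_def)

lemma N_le_power: "N \<le> card (verts G) ^ Suc l"
  unfolding N_card using card_mono[OF finite_lists_length_eq[OF finite_verts] min_paths_lists]
  by (simp add: card_lists_length_eq[OF finite_verts])

lemma min_path_inj: "vs \<in> min_paths \<Longrightarrow> inj_on (nth vs) {..l}"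
  by (auto simp: min_paths_def inj_on_def nth_eq_iff_index_eq)

text \<open>A stored path can be recovered from its subgraph: it starts at the least vertex, and
  \<open>path_determined\<close> yields the rest.\<close>

lemma N_le_paths: "N \<le> card (occurrences (path_graph l) G)"
  unfolding N_card
proof (rule card_inj_on_le)
  show "inj_on (\<lambda>vs. graph_image (nth vs) (path_graph l)) min_paths"
  proof (rule inj_onI)
    fix vs ws assume vs: "vs \<in> min_paths" and ws: "ws \<in> min_paths"
      and eq: "graph_image (nth vs) (path_graph l) = graph_image (nth ws) (path_graph l)"
    have "nth vs ` {..l} = set vs" "nth ws ` {..l} = set ws"
      using vs ws by (auto simp: min_paths_def set_conv_nth less_Suc_eq_le)
    moreover have "nth vs ` {..l} = nth ws ` {..l}"
      using arg_cong[OF eq, of verts] by (simp add: image_path_graph)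
    moreover have "vs ! 0 \<in> set vs" "ws ! 0 \<in> set ws" using vs ws by (auto simp: min_paths_def)
    ultimately have "vs ! 0 = ws ! 0"
      using vs ws precedes_simps(2) by (auto simp: min_paths_def)
    then have "vs ! k = ws ! k" if "k \<le> l" for k
      using path_determined[OF min_path_inj[OF vs] min_path_inj[OF ws]] eq that by simp
    then show "vs = ws"
      using vs ws by (intro nth_equalityI) (auto simp: min_paths_def)
  qed
  show "(\<lambda>vs. graph_image (nth vs) (path_graph l)) ` min_paths \<subseteq> occurrences (path_graph l) G"
  proof (rule image_subsetI)
    fix vs assume vs: "vs \<in> min_paths"
    have "vs ! i \<noteq> vs ! Suc i" if "i < l" for i
      using vs that by (simp add: min_paths_def nth_eq_iff_index_eq)
    moreover have "vs ! i \<in> verts G" if "i \<le> l" for i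
      using vs that by (auto simp: min_paths_def)
    ultimately show "graph_image (nth vs) (path_graph l) \<in> occurrences (path_graph l) G"
      using vs min_path_inj[OF vs]
      by (auto simp: occurrences_def subgraph_def isomorphic_def simple_graph_def image_path_graph)
         (auto simp: path_graph_def min_paths_def image_path_graph[unfolded path_graph_def])
  qed
qed (rule finite_occurrences[OF simple])

lemma N_less: "N < 2 ^ J"
  unfolding J_def by (rule LeastI[of _ N]) (rule less_exp)

lemma J_le: "0 < N \<Longrightarrow> 2 ^ J \<le> 2 * N"
proof (cases J)
  case (Suc j)
  have "\<not> N < 2 ^ j"
  proof
    assume "N < 2 ^ j"
    then have "J \<le> j" unfolding J_def by (rule Least_le)
    then show False using Suc by simp
  qed
  then show ?thesis unfolding Suc by simp
qed simp

lemma path_mem: "i < N \<Longrightarrow> paths ! i \<in> min_paths"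
  unfolding paths(1)[symmetric] N_def by (rule nth_mem)

lemma key_mono: "i \<le> j \<Longrightarrow> j < N \<Longrightarrow> key (paths ! i) \<le> key (paths ! j)"
  unfolding N_def using sorted_nth_mono[OF sorted_paths, of i j] by simp

lemma key_path: "key (paths ! i) = (- lo i, vert i 0, vert i l, hi i)"
  by (simp add: key_def lo_def vert_def hi_def)

lemma vert_facts:
  assumes "i < N"
  shows "k \<le> l \<Longrightarrow> vert i k \<in> verts G" "inj_on (vert i) {..l}" "k \<le> l \<Longrightarrow> precedes (vert i 0) (vert i k)"
    "k < l \<Longrightarrow> {vert i k, vert i (Suc k)} \<in> edges G" "hi i \<le> x \<longleftrightarrow> (\<forall>k\<le>l. A (vert i k) \<le> x)"
proof -
  note i = path_mem[OF assms]
  then have len: "length (paths ! i) = Suc l" by (simp add: min_paths_def)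
  show "k \<le> l \<Longrightarrow> vert i k \<in> verts G" "k \<le> l \<Longrightarrow> precedes (vert i 0) (vert i k)"
    "k < l \<Longrightarrow> {vert i k, vert i (Suc k)} \<in> edges G"
    using i len by (auto simp: min_paths_def vert_def)
  show "inj_on (vert i) {..l}" using min_path_inj[OF i] by (simp add: vert_def[abs_def])
  have "set (paths ! i) = vert i ` {..l}"
    using len by (auto simp: vert_def set_conv_nth less_Suc_eq_le)
  then show "hi i \<le> x \<longleftrightarrow> (\<forall>k\<le>l. A (vert i k) \<le> x)" by (auto simp: hi_def)
qed

lemma path_index: "vs \<in> min_paths \<Longrightarrow> \<exists>i<N. \<forall>k\<le>l. vert i k = vs ! k"
  using paths(1) by (auto simp: N_def vert_def in_set_conv_nth) (metis in_set_conv_nth)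

lemma vert_eqD:
  assumes "i < N" "j < N" "\<And>k. k \<le> l \<Longrightarrow> vert i k = vert j k" shows "i = j"
proof -
  have "paths ! i = paths ! j"
    using path_mem[OF assms(1)] path_mem[OF assms(2)] assms(3)
    by (intro nth_equalityI) (auto simp: min_paths_def vert_def)
  then show ?thesis using assms paths(2) by (simp add: N_def nth_eq_iff_index_eq)
qed

lemma start: "start q \<le> q" "same_ends (start q) q"
proof -
  have "same_ends q q" by (simp add: same_ends_def)
  then show "start q \<le> q" "same_ends (start q) q"
    unfolding start_def by (rule Least_le, rule LeastI)
qed

text \<open>The key of \<open>p\<close> lies between those of \<open>start q\<close> and
  \<open>q\<close>, which agree in the three leading components; in a lexicographic order this
  forces \<open>p\<close> to agree with them too.\<close>

lemma same_ends_iff: "p < q \<Longrightarrow> q < N \<Longrightarrow> same_ends p q \<longleftrightarrow> start q \<le> p"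
proof
  assume a: "p < q" "q < N" "start q \<le> p"
  have "key (paths ! start q) \<le> key (paths ! p)" "key (paths ! p) \<le> key (paths ! q)"
    using a key_mono by auto
  moreover have "lo (start q) = lo q" using start(2)[of q] by (simp add: same_ends_def lo_def)
  ultimately show "same_ends p q"
    using start(2)[of q] by (auto simp: key_path same_ends_def)
qed (simp add: start_def Least_le)

lemma hi_mono: "p < q \<Longrightarrow> q < N \<Longrightarrow> same_ends p q \<Longrightarrow> hi p \<le> hi q"
  using key_mono[of p q] by (auto simp: key_path same_ends_def lo_def)

lemma lo_antimono: "i \<le> j \<Longrightarrow> j < N \<Longrightarrow> lo j \<le> lo i"
  using key_mono[of i j] by (auto simp: key_path)

lemma inner_disjoint:
  "inner p \<inter> inner q = {} \<longleftrightarrow> rows_disjoint l vert p q"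
  by (auto simp: inner_def rows_disjoint_def)

lemma cand:
  assumes "i < N"
  shows "cand i j c \<in> block i j" "r \<in> block i j \<Longrightarrow> active r \<Longrightarrow> active (cand i j 0) \<and> hi (cand i j 0) \<le> hi r"
    "r \<in> block i j \<Longrightarrow> inner r \<inter> inner q = {} \<Longrightarrow> \<exists>c\<in>{1..K}. inner (cand i j c) \<inter> inner q = {}"
proof -
  have "finite (block i j)" "i \<in> block i j" using assms by (auto simp: block_def)
  moreover have "finite (inner i) \<and> card (inner i) \<le> l - 1" for i
    unfolding inner_def using card_image_le[of "{1..<l}" "vert i"] by simp
  ultimately have "\<exists>f. (\<forall>c. f c \<in> block i j) \<and>
     (\<forall>r\<in>block i j. active r \<longrightarrow> active (f 0) \<and> hi (f 0) \<le> hi r) \<and>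
     (\<forall>r\<in>block i j. \<forall>q. inner r \<inter> inner q = {} \<longrightarrow> (\<exists>c\<in>{1..K}. inner (f c) \<inter> inner q = {}))"
    unfolding K_def by (intro candidates_exist) auto
  from someI_ex[OF this, folded cand_def]
  show "cand i j c \<in> block i j" "r \<in> block i j \<Longrightarrow> active r \<Longrightarrow> active (cand i j 0) \<and> hi (cand i j 0) \<le> hi r"
    "r \<in> block i j \<Longrightarrow> inner r \<inter> inner q = {} \<Longrightarrow> \<exists>c\<in>{1..K}. inner (cand i j c) \<inter> inner q = {}"
    by blast+
qed

lemma layout:
  assumes "0 < N" "N * row_width l K J < 2 ^ w" "N + 2 ^ J < 2 ^ w" "\<And>v. v \<in> verts G \<Longrightarrow> v < 2 ^ w"
  shows "layout l K N J w start active vert cand lo hi"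
proof
  show "cand i j c \<in> {i..<i + 2 ^ j} \<inter> {..<N}" if "i < N" for i j c
    using cand(1)[OF that] by (simp add: block_def)
  show "active (cand i j 0) \<and> hi (cand i j 0) \<le> hi r"
    if "i < N" "r \<in> {i..<i + 2 ^ j} \<inter> {..<N}" "active r" for i j r
    using cand(2)[OF that(1)] that by (simp add: block_def)
  show "\<exists>c\<in>{1..K}. rows_disjoint l vert (cand i j c) q"
    if "i < N" "r \<in> {i..<i + 2 ^ j} \<inter> {..<N}" "rows_disjoint l vert r q" for i j r q
    using cand(3)[OF that(1), of r j q] that unfolding inner_disjoint block_def by blast
  show "active q \<longleftrightarrow> (\<exists>p\<in>{start q..<q}. rows_disjoint l vert p q)" for q
    unfolding active_def inner_disjoint ..
qed (use assms l2 N_less lo_antimono start vert_facts(1) in auto)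

section \<open>Pairs of rows correspond to cycles in the range\<close>

definition cyc :: "nat \<times> nat \<Rightarrow> nat \<Rightarrow> nat" where
  "cyc = (\<lambda>(p, q) k. if k \<le> l then vert p k else vert q (2 * l - k))"

definition pairs :: "real \<Rightarrow> real \<Rightarrow> (nat \<times> nat) set" where
  "pairs x1 x2 = {(p, q). p < q \<and> q < N \<and> same_ends p q \<and> inner p \<inter> inner q = {} \<and> x1 \<le> lo q \<and> hi q \<le> x2}"

abbreviation "C \<equiv> cycle_graph (2 * l)"

lemma cyc_low: "k \<le> l \<Longrightarrow> cyc (p, q) k = vert p k"
  by (simp add: cyc_def)

lemma cyc_high: "same_ends p q \<Longrightarrow> l \<le> k \<Longrightarrow> cyc (p, q) k = vert q (2 * l - k)"
  by (cases "k = l") (auto simp: cyc_def same_ends_def)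

lemma cyc_Suc_high: "same_ends p q \<Longrightarrow> l \<le> k \<Longrightarrow> k < 2 * l \<Longrightarrow> cyc (p, q) (Suc k mod (2 * l)) = vert q (2 * l - Suc k)"
  using cyc_high[of p q "Suc k"] by (cases "Suc k = 2 * l") (auto simp: cyc_def same_ends_def)

lemma pairs_cycle:
  assumes "(p, q) \<in> pairs x1 x2"
  shows "cycle_in (2 * l) (cyc (p, q)) (range_graph (G, A) x1 x2)" "\<And>k. k < 2 * l \<Longrightarrow> precedes (cyc (p, q) 0) (cyc (p, q) k)"
proof -
  have pq: "p < N" "q < N" "same_ends p q" "inner p \<inter> inner q = {}" "x1 \<le> lo q" "hi q \<le> x2" "hi p \<le> x2"
    using assms hi_mono[of p q] by (auto simp: pairs_def)
  have low: "vert p 0 = vert q 0" "vert p l = vert q l" using pq by (simp_all add: same_ends_def)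
  \<comment> \<open>Disjointness speaks of inner positions only; the end of \<open>p\<close> is
    compared with inner vertices of \<open>q\<close> through the shared end, by injectivity of the
    path of \<open>q\<close>.\<close>
  have ne: "vert p a \<noteq> vert q b" if "a < l" "0 < b" "b < l" for a b
  proof (cases "a = 0")
    case True
    then show ?thesis using low inj_onD[OF vert_facts(2)[OF pq(2)], of 0 b] that by auto
  next
    case False
    then show ?thesis using pq(4) that unfolding inner_disjoint rows_disjoint_def by auto
  qed
  have ne': "vert p a \<noteq> vert q b" if "a \<le> l" "0 < b" "b < l" for a b
  proof (cases "a = l")
    case True
    then show ?thesis using low inj_onD[OF vert_facts(2)[OF pq(2)], of l b] that by auto
  qed (use ne that in auto)
  have inj: "inj_on (cyc (p, q)) {..<2 * l}"
  proof (rule linorder_inj_onI)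
    fix a b assume ab: "a < b" "a \<in> {..<2 * l}" "b \<in> {..<2 * l}"
    consider "b \<le> l" | "a \<le> l" "l < b" | "l < a" by linarith
    then show "cyc (p, q) a \<noteq> cyc (p, q) b"
    proof cases
      case 1
      then show ?thesis using ab inj_onD[OF vert_facts(2)[OF pq(1)], of a b] by (auto simp: cyc_def)
    next
      case 2
      then show ?thesis using ne'[of a "2 * l - b"] ab by (auto simp: cyc_def)
    next
      case 3
      have "2 * l - a \<noteq> 2 * l - b" "2 * l - a \<le> l" "2 * l - b \<le> l" using 3 ab by auto
      then show ?thesis using 3 ab inj_onD[OF vert_facts(2)[OF pq(2)], of "2 * l - a" "2 * l - b"]
        by (auto simp: cyc_def)
    qed
  qed auto
  have prec: "precedes (vert q 0) (cyc (p, q) k)" "cyc (p, q) k \<in> verts G" "A (cyc (p, q) k) \<le> x2" if "k < 2 * l" for k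
    using vert_facts(1,3,5)[OF pq(1)] vert_facts(1,3,5)[OF pq(2)] pq low that by (auto simp: cyc_def)
  then have vs: "cyc (p, q) k \<in> {v \<in> verts G. x1 \<le> A v \<and> A v \<le> x2}" if "k < 2 * l" for k
    using precedes_simps(3)[OF prec(1)[OF that]] pq(5) that by (auto simp: lo_def)
  have edge: "{cyc (p, q) k, cyc (p, q) (Suc k mod (2 * l))} \<in> edges G" if k: "k < 2 * l" for k
  proof (cases "k < l")
    case True
    then show ?thesis using vert_facts(4)[OF pq(1)] by (simp add: cyc_low)
  next
    case False
    moreover have "2 * l - k = Suc (2 * l - Suc k)" using k by simp
    ultimately show ?thesis
      using vert_facts(4)[OF pq(2), of "2 * l - Suc k"] k pq(3)
      by (simp add: cyc_high cyc_Suc_high insert_commute)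
  qed
  have "Suc k mod (2 * l) < 2 * l" for k using l2 by simp
  then show "cycle_in (2 * l) (cyc (p, q)) (range_graph (G, A) x1 x2)"
    using inj edge vs by (auto simp: cycle_in_def range_graph_def induced_def)
  show "precedes (cyc (p, q) 0) (cyc (p, q) k)" if "k < 2 * l" for k
    using prec(1)[OF that] low by (simp add: cyc_def)
qed

text \<open>Both maps have the least vertex of the cycle at position 0, so by
  \<open>cycle_unique\<close> they agree or are reflections of each other. A reflection exchanges
  the two paths, which \<open>p < q\<close> and \<open>p' < q'\<close> forbid.\<close>

lemma pairs_inj: "inj_on (\<lambda>x. graph_image (cyc x) C) (pairs x1 x2)"
proof (rule inj_onI)
  fix x y assume xy: "x \<in> pairs x1 x2" "y \<in> pairs x1 x2" "graph_image (cyc x) C = graph_image (cyc y) C"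
  obtain p q p' q' where eq: "x = (p, q)" "y = (p', q')" by force
  have lt: "p < q" "p' < q'" "q < N" "q' < N" "same_ends p q" "same_ends p' q'"
    using xy eq by (auto simp: pairs_def)
  have N: "p < N" "p' < N" using lt by auto
  have inj: "inj_on (cyc x) {..<2 * l}" "inj_on (cyc y) {..<2 * l}"
    using pairs_cycle(1) xy eq by (auto simp: cycle_in_def)
  have im: "cyc x ` {..<2 * l} = cyc y ` {..<2 * l}"
    using arg_cong[OF xy(3), of verts] by (simp add: image_cycle_graph)
  have "0 \<in> {..<2 * l}" using l2 by simp
  then have "cyc x 0 \<in> cyc y ` {..<2 * l}" "cyc y 0 \<in> cyc x ` {..<2 * l}"
    using im by blast+
  moreover have "precedes (cyc y 0) v" if "v \<in> cyc y ` {..<2 * l}" for v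
    using that pairs_cycle(2)[OF xy(2)[unfolded eq]] by (auto simp: eq)
  moreover have "precedes (cyc x 0) v" if "v \<in> cyc x ` {..<2 * l}" for v
    using that pairs_cycle(2)[OF xy(1)[unfolded eq]] by (auto simp: eq)
  ultimately have "cyc x 0 = cyc y 0" using precedes_simps(2) by blast
  then consider "\<forall>k<2 * l. cyc x k = cyc y k" | "\<forall>k<2 * l. cyc x k = cyc y ((2 * l - k) mod (2 * l))"
    using cycle_unique[OF _ inj xy(3)] l2 by auto
  then show "x = y"
  proof cases
    case 1
    have "vert p k = vert p' k" if "k \<le> l" for k
      using 1[rule_format, of k] that l2 by (simp add: eq cyc_low)
    then have "p = p'" by (rule vert_eqD[OF N(1,2)])
    moreover have "vert q k = vert q' k" if "k \<le> l" for k
    proof (cases "k = 0")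
      case True
      then show ?thesis using lt(5,6) \<open>p = p'\<close> by (simp add: same_ends_def)
    next
      case False
      then show ?thesis using 1[rule_format, of "2 * l - k"] that lt(5,6) by (simp add: eq cyc_high)
    qed
    then have "q = q'" by (rule vert_eqD[OF lt(3,4)])
    ultimately show ?thesis by (simp add: eq)
  next
    case 2
    have "vert p k = vert q' k" if "k \<le> l" for k
    proof (cases "k = 0")
      case True
      then show ?thesis using 2[rule_format, of 0] l2 lt(6) by (simp add: eq cyc_low same_ends_def)
    next
      case False
      then show ?thesis using 2[rule_format, of k] that l2 lt(6) by (simp add: eq cyc_low cyc_high)
    qed
    then have "p = q'" by (rule vert_eqD[OF N(1) lt(4)])
    moreover have "vert q k = vert p' k" if "k \<le> l" for k
    proof (cases "k = 0")
      case True
      then show ?thesis using \<open>p = q'\<close> lt(5,6) by (simp add: same_ends_def)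
    next
      case False
      then show ?thesis using 2[rule_format, of "2 * l - k"] that l2 lt(5) by (simp add: eq cyc_low cyc_high)
    qed
    then have "q = p'" by (rule vert_eqD[OF lt(3) N(2)])
    ultimately show ?thesis using lt by simp
  qed
qed

lemma half_cycle_path:
  assumes "cycle_in (2 * l) f (range_graph (G, A) x1 x2)" "\<And>k. k < 2 * l \<Longrightarrow> precedes (f 0) (f k)"
  shows "map f [0..<Suc l] \<in> min_paths"
proof -
  have f: "inj_on f {..<2 * l}" "\<And>k. k < 2 * l \<Longrightarrow> f k \<in> verts G" "\<And>i. i < 2 * l \<Longrightarrow> {f i, f (Suc i mod (2 * l))} \<in> edges G"
    using assms(1) by (auto simp: cycle_in_def range_graph_def induced_def)
  have "{f i, f (Suc i)} \<in> edges G" if "i < l" for i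
    using f(3)[of i] that l2 by simp
  moreover have "inj_on f {0..<Suc l}" using f(1) by (rule inj_on_subset) (use l2 in auto)
  moreover have "map f [0..<Suc l] ! k = f k" if "k \<le> l" for k
    using that nth_map_upt[of k "Suc l" 0 f] by simp
  moreover have "k < 2 * l" if "k < Suc l" for k using that l2 by simp
  ultimately show ?thesis
    using f(2) assms(2) by (auto simp: min_paths_def distinct_map simp del: upt_Suc)
qed

text \<open>Formulated for either orientation of the cycle: \<open>pairs_surj\<close> applies it to
  a map or to its reflection, depending on which of the two paths comes first in the table.\<close>

lemma pair_of_cycle:
  assumes f: "cycle_in (2 * l) f (range_graph (G, A) x1 x2)" "\<And>k. k < 2 * l \<Longrightarrow> precedes (f 0) (f k)"
    and p: "\<And>k. k \<le> l \<Longrightarrow> vert p k = f k" and q: "\<And>k. k \<le> l \<Longrightarrow> vert q k = f ((2 * l - k) mod (2 * l))"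
    and pq: "p < q" "q < N"
  shows "graph_image f C \<in> (\<lambda>x. graph_image (cyc x) C) ` pairs x1 x2"
proof (rule image_eqI)
  have f': "inj_on f {..<2 * l}" "\<And>k. k < 2 * l \<Longrightarrow> x1 \<le> A (f k) \<and> A (f k) \<le> x2"
    using f(1) by (auto simp: cycle_in_def range_graph_def induced_def)
  have "cyc (p, q) k = f k" if "k < 2 * l" for k
    using that p[of k] q[of "2 * l - k"] by (auto simp: cyc_def)
  then show "graph_image f C = graph_image (cyc (p, q)) C"
    by (intro image_cycle_graph_cong) simp
  have "vert p a \<noteq> vert q b" if "a \<in> {1..<l}" "b \<in> {1..<l}" for a b
    using p[of a] q[of b] that inj_onD[OF f'(1), of a "2 * l - b"] by auto
  then have "inner p \<inter> inner q = {}" unfolding inner_disjoint rows_disjoint_def by blast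
  moreover have "same_ends p q" using p[of 0] p[of l] q[of 0] q[of l] l2 by (simp add: same_ends_def)
  moreover have "x1 \<le> lo q" using q[of 0] f'(2)[of 0] l2 by (simp add: lo_def)
  moreover have "hi q \<le> x2"
    using q f'(2) l2 by (subst vert_facts(5)[OF pq(2)]) simp
  ultimately show "(p, q) \<in> pairs x1 x2" using pq by (simp add: pairs_def)
qed

text \<open>Rotating the least vertex of a cycle to position 0 makes the two halves, read away from
  that vertex, stored paths.\<close>

lemma pairs_surj:
  "(\<lambda>x. graph_image (cyc x) C) ` pairs x1 x2 = occurrences C (range_graph (G, A) x1 x2)"
proof (intro equalityI subsetI)
  fix H assume "H \<in> (\<lambda>x. graph_image (cyc x) C) ` pairs x1 x2"
  then show "H \<in> occurrences C (range_graph (G, A) x1 x2)"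
    using pairs_cycle(1) l2 by (subst cycle_occurrences) auto
next
  let ?m = "2 * l"
  fix H assume "H \<in> occurrences C (range_graph (G, A) x1 x2)"
  then obtain f0 where H0: "H = graph_image f0 C" and f0: "cycle_in ?m f0 (range_graph (G, A) x1 x2)"
    using cycle_occurrences[of ?m] l2 by auto
  have m: "0 < ?m" using l2 by simp
  have "f0 0 \<in> f0 ` {..<?m}" using m by simp
  then obtain r where r: "r < ?m" "\<forall>k<?m. precedes (f0 r) (f0 k)"
    using precedes_least[of "f0 ` {..<?m}"] by auto
  define f where "f = (\<lambda>k. f0 ((k + r) mod ?m))"
  define g where "g = (\<lambda>k. f ((?m - k) mod ?m))"
  have f: "cycle_in ?m f (range_graph (G, A) x1 x2)" "H = graph_image f C"
    unfolding f_def H0 by (rule cycle_in_rotate[OF m f0], rule image_cycle_graph_rotate[OF m, symmetric])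
  have g: "cycle_in ?m g (range_graph (G, A) x1 x2)" "H = graph_image g C"
    unfolding g_def f(2) by (rule cycle_in_reflect[OF m f(1)], rule image_cycle_graph_reflect[OF m, symmetric])
  have fmin: "precedes (f 0) (f k)" for k
    using r m by (simp add: f_def)
  then have gmin: "precedes (g 0) (g k)" for k by (simp add: g_def)
  have "map f [0..<Suc l] \<in> min_paths" "map g [0..<Suc l] \<in> min_paths"
    using half_cycle_path f(1) g(1) fmin gmin by blast+
  then obtain p q where p: "p < N" "\<forall>k\<le>l. vert p k = map f [0..<Suc l] ! k"
    and q: "q < N" "\<forall>k\<le>l. vert q k = map g [0..<Suc l] ! k"
    using path_index by meson
  have p': "vert p k = f k" and q': "vert q k = g k" if "k \<le> l" for k
    using p(2) q(2) that nth_map_upt[of k "Suc l" 0] by (simp_all del: upt_Suc)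
  have fg: "f k = g ((?m - k) mod ?m)" if "k \<le> l" for k
    using reflect_reflect[of k ?m] that l2 by (simp add: g_def)
  \<comment> \<open>\<open>g 1\<close> is \<open>f (2 * l - 1)\<close>, a different position because
    \<open>l\<close> is at least 2. Hence the halves are two distinct rows and one of them comes
    first.\<close>
  have "f 1 \<noteq> g 1"
    using f(1) l2 inj_onD[of f "{..<?m}" 1 "?m - 1"] by (auto simp: g_def cycle_in_def)
  then have "p \<noteq> q" using p'[of 1] q'[of 1] l2 by auto
  then consider "p < q" | "q < p" by linarith
  then show "H \<in> (\<lambda>x. graph_image (cyc x) C) ` pairs x1 x2"
  proof cases
    case 1
    show ?thesis unfolding f(2)
      by (rule pair_of_cycle[OF f(1) fmin p' _ 1 q(1)]) (simp_all add: q' g_def)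
  next
    case 2
    show ?thesis unfolding g(2)
      by (rule pair_of_cycle[OF g(1) gmin q' _ 2 p(1)]) (simp_all add: p' fg)
  qed
qed

lemma lists_all_cycles:
  assumes "layout l K N J w start active vert cand lo hi"
  shows "lists_occurrences C (range_graph (G, A) x1 x2)
    (map (layout.out l vert) (layout.outer_pairs l N start active vert lo hi x1 x2 0))"
proof -
  let ?ps = "layout.outer_pairs l N start active vert lo hi x1 x2 0" and ?out = "layout.out l vert"
  note outer_pairs_def = layout.outer_pairs_def[OF assms] and inner_pairs_def = layout.inner_pairs_def[OF assms]
    and out_def = layout.out_def[OF assms]
  have mem: "(p, q) \<in> set ?ps \<longleftrightarrow> q < N \<and> active q \<and> hi q \<le> x2 \<and> x1 \<le> lo q \<and>
      start q \<le> p \<and> p < q \<and> inner p \<inter> inner q = {}" for p q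
    unfolding outer_pairs_def inner_pairs_def inner_disjoint[symmetric] by auto
  \<comment> \<open>Membership in \<open>pairs\<close> does not mention activity; any partner
    witnesses it.\<close>
  have "active q" if "start q \<le> p" "p < q" "inner p \<inter> inner q = {}" for p q
    unfolding active_def using that by auto
  then have "(p, q) \<in> set ?ps \<longleftrightarrow> (p, q) \<in> pairs x1 x2" for p q
    unfolding mem pairs_def mem_Collect_eq case_prod_conv using same_ends_iff[of p q] by blast
  then have set: "set ?ps = pairs x1 x2" by auto
  have "distinct ?ps"
    unfolding outer_pairs_def
    by (rule distinct_concat_map) (auto simp: inner_pairs_def distinct_map inj_on_def)
  moreover have im: "graph_image (nth (?out x)) C = graph_image (cyc x) C" for x
    by (intro image_cycle_graph_cong) (simp add: out_def cyc_def split: prod.splits)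
  ultimately have "distinct (map (\<lambda>vs. graph_image (nth vs) C) (map ?out ?ps))"
    unfolding map_map comp_def im distinct_map set using pairs_inj by blast
  moreover have "set (map (\<lambda>vs. graph_image (nth vs) C) (map ?out ?ps)) = occurrences C (range_graph (G, A) x1 x2)"
    unfolding pairs_surj[symmetric] set[symmetric] by (simp only: set_map image_image im)
  moreover have "length v = card (verts C)" if "v \<in> set (map ?out ?ps)" for v
    using that by (auto simp: out_def cycle_graph_def)
  ultimately show ?thesis unfolding lists_occurrences_def by blast
qed

end

section \<open>The data structure\<close>

text \<open>Execution is deterministic, so the run that restores \<open>M0\<close> is the only one,
  and no sequence of queries leaves \<open>M0\<close>.\<close>

lemma reachable_readonly:
  assumes "\<And>x1 x2. \<exists>tr s. exec w P (query_state M0 x1 x2) tr s \<and> (mem s, rmem s) = M0"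
    and "M \<in> reachable w P M0"
  shows "M = M0"
  using assms(2)
proof induction
  case (query M x1 x2 tr s)
  obtain tr' s' where "exec w P (query_state M0 x1 x2) tr' s'" "(mem s', rmem s') = M0"
    using assms(1) by blast
  then show ?case using exec_deterministic query by metis
qed simp

text \<open>With \<open>m = n + 2\<close>, two factors \<open>N\<close> contribute
  \<open>2 * (l + 1)\<close> to the exponent of \<open>m\<close>, and the constant
  \<open>9 + l + 2 * K\<close> from the row width contributes itself, because
  \<open>x < 2 ^ x\<close> and \<open>m\<close> is at least 2.\<close>

definition word_factor :: "nat \<Rightarrow> nat" where
  "word_factor l = 3 * l + 11 + 2 * rep_bound (l - 1) (l - 1)"

section \<open>Word length, number of levels and space\<close>

context input_graph
begin

definition contents :: memory where
  "contents = (table N (row_width l K J) (row_field l K N J start active vert cand),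
     map lo [0..<N] @ map hi [0..<N])"

lemma log_verts: "1 \<le> log 2 (real (card (verts G)) + 2)"
  by simp

lemma card_le_word:
  "(card (verts G) + 2) ^ word_factor l \<le> 2 ^ word_length (word_factor l) (G, A)"
proof -
  let ?m = "card (verts G) + 2" and ?L = "nat \<lceil>log 2 (real (card (verts G)) + 2)\<rceil>"
  have "real ?m = 2 powr log 2 (real ?m)" by simp
  also have "\<dots> \<le> 2 powr real ?L"
    by (intro powr_mono) (use real_nat_ceiling_ge in \<open>simp_all add: add.commute\<close>)
  also have "\<dots> = 2 ^ ?L" by (rule powr_realpow) simp
  finally have "real ?m \<le> real (2 ^ ?L)" by (simp only: of_nat_power of_nat_numeral)
  then have "?m \<le> 2 ^ ?L" by (simp only: of_nat_le_iff)
  then have "?m ^ word_factor l \<le> (2 ^ ?L) ^ word_factor l" by (rule power_mono) simp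
  then show ?thesis by (simp add: word_length_def num_verts_def power_mult[symmetric] mult.commute)
qed

lemma layout_words:
  assumes "0 < N" "verts G = {..<card (verts G)}"
  shows "layout l K N J (word_length (word_factor l) (G, A)) start active vert cand lo hi"
proof (rule layout[OF assms(1)])
  let ?m = "card (verts G) + 2" and ?w = "word_length (word_factor l) (G, A)"
  have N: "N \<le> ?m ^ Suc l"
    by (rule order_trans[OF N_le_power]) (intro power_mono, simp_all)
  have "J < 2 ^ J" by (rule less_exp)
  \<comment> \<open>A very crude bound on \<open>J\<close>, sufficient because the width only has to
    be polynomial in the number of vertices here.\<close>
  then have "J \<le> 2 * N" using J_le[OF assms(1)] by linarith
  then have "J * Suc K \<le> (2 * N) * Suc K" by (rule mult_le_mono1)
  then have "row_width l K J \<le> (7 + l) + N * (2 * Suc K)" by (simp add: row_width_def)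
  also have "7 + l \<le> N * (7 + l)" using assms by simp
  finally have W: "row_width l K J \<le> N * (9 + l + 2 * K)" by (simp add: algebra_simps)
  have "N * row_width l K J \<le> (N * N) * (9 + l + 2 * K)" using mult_le_mono2[OF W, of N] by (simp only: mult.assoc)
  also have "\<dots> < (N * N) * 2 ^ (9 + l + 2 * K)" using assms(1)
    by (intro mult_strict_left_mono less_exp) simp
  also have "\<dots> \<le> (?m ^ Suc l * ?m ^ Suc l) * ?m ^ (9 + l + 2 * K)"
    using N by (intro mult_mono power_mono) auto
  also have "\<dots> = ?m ^ word_factor l"
  proof -
    have "Suc l + Suc l + (9 + l + 2 * K) = word_factor l" by (simp add: word_factor_def K_def)
    then show ?thesis by (simp only: power_add[symmetric])
  qed
  also have "\<dots> \<le> 2 ^ ?w" by (rule card_le_word)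
  finally show word: "N * row_width l K J < 2 ^ ?w" .
  \<comment> \<open>Since \<open>2 ^ J\<close> is at most \<open>2 * N\<close>, the sum
    \<open>N + 2 ^ J\<close> is at most \<open>3 * N\<close>.\<close>
  have "N * 3 \<le> N * row_width l K J" by (intro mult_le_mono2) (simp add: row_width_def)
  then show "N + 2 ^ J < 2 ^ ?w" using word J_le[OF assms(1)] by linarith
  fix v assume "v \<in> verts G"
  then have "v < ?m ^ 1" using assms(2) by (metis add.commute lessThan_iff power_one_right trans_less_add2)
  also have "\<dots> \<le> ?m ^ word_factor l" by (intro power_increasing) (simp_all add: word_factor_def)
  also have "\<dots> \<le> 2 ^ ?w" by (rule card_le_word)
  finally show "v < 2 ^ ?w" .
qed

text \<open>By minimality of \<open>J\<close>, \<open>2 ^ J\<close> is at most \<open>2 * N\<close>,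
  and \<open>N\<close> is polynomial in the number of vertices. The shift by 2 makes the logarithm
  at least 1, which absorbs the extra summand 1.\<close>

lemma J_log: "real J \<le> real (l + 2) * log 2 (real (card (verts G)) + 2)"
proof (cases "N = 0")
  case True
  then have "J = 0" unfolding J_def by (simp add: Least_eq_0)
  then show ?thesis using log_verts by simp
next
  case False
  let ?m = "real (card (verts G)) + 2"
  have "real (2 ^ J) \<le> real (2 * N)" using J_le False by (intro of_nat_mono) simp
  also have "real N \<le> ?m ^ Suc l"
  proof -
    have "real N \<le> real (card (verts G)) ^ Suc l"
      using N_le_power of_nat_mono[of N "card (verts G) ^ Suc l"] by simp
    also have "\<dots> \<le> ?m ^ Suc l" by (intro power_mono) auto
    finally show ?thesis .
  qed
  then have "real (2 * N) \<le> 2 * ?m ^ Suc l" by simp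
  finally have "log 2 (real (2 ^ J)) \<le> log 2 (2 * ?m ^ Suc l)" by (intro log_mono) simp_all
  also have "\<dots> = 1 + real (Suc l) * log 2 ?m"
    by (subst log_mult) (auto simp: log_nat_power simp del: power_Suc)
  also have "\<dots> \<le> real (l + 2) * log 2 ?m" using log_verts by (simp add: algebra_simps)
  finally show ?thesis by (simp add: log_nat_power)
qed

lemma contents_size:
  "real (memory_size contents) \<le> real (9 + l + (l + 2) * Suc K) * real (card (occurrences (path_graph l) G)) *
     log 2 (real (card (verts G)) + 2)"
proof -
  let ?L = "log 2 (real (card (verts G)) + 2)"
  \<comment> \<open>Each row takes its width in words and two reals, which turns
    \<open>7 + l\<close> into \<open>9 + l\<close>.\<close>
  have "real (memory_size contents) = real N * (9 + real l + real J * real (Suc K))"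
    by (simp add: memory_size_def contents_def table_def row_width_def algebra_simps)
  also have "\<dots> \<le> real N * ((9 + real l) * ?L + (real (l + 2) * ?L) * real (Suc K))"
  proof (intro mult_left_mono add_mono mult_right_mono J_log)
    show "9 + real l \<le> (9 + real l) * ?L" using mult_left_mono[OF log_verts, of "9 + real l"] by simp
  qed auto
  also have "\<dots> = real N * (real (9 + l + (l + 2) * Suc K) * ?L)" by (simp add: algebra_simps)
  also have "\<dots> \<le> real (card (occurrences (path_graph l) G)) * (real (9 + l + (l + 2) * Suc K) * ?L)"
    using N_le_paths log_verts by (intro mult_right_mono mult_nonneg_nonneg) simp_all
  finally show ?thesis by (simp only: mult_ac)
qed

lemma query_contents:
  assumes "verts G = {..<card (verts G)}"
  shows "\<exists>tr s. exec (word_length (word_factor l) (G, A)) (query_prog l K) (query_state contents x1 x2) tr s \<and>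
     (mem s, rmem s) = contents \<and> lists_occurrences (cycle_graph (2 * l)) (range_graph (G, A) x1 x2) (outputs tr) \<and>
     has_delay tr (query_delay l K J)"
    and "x \<in> set (fst contents) \<Longrightarrow> x < 2 ^ word_length (word_factor l) (G, A)"
proof -
  let ?w = "word_length (word_factor l) (G, A)"
  show "\<exists>tr s. exec ?w (query_prog l K) (query_state contents x1 x2) tr s \<and>
     (mem s, rmem s) = contents \<and> lists_occurrences C (range_graph (G, A) x1 x2) (outputs tr) \<and>
     has_delay tr (query_delay l K J)"
  proof (cases "N = 0")
    case True
    \<comment> \<open>With no rows \<open>pairs\<close> is empty, so by \<open>pairs_surj\<close>
      there is no cycle to report; \<open>layout\<close> treats the case
      \<open>0 < N\<close>.\<close>
    then have "contents = ([], [])" by (simp add: contents_def table_def)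
    moreover have "0 < ?w"
      using log_verts by (simp add: word_length_def word_factor_def num_verts_def)
    moreover have "lists_occurrences C (range_graph (G, A) x1 x2) []"
      using True pairs_surj[of x1 x2] by (simp add: lists_occurrences_def pairs_def)
    ultimately show ?thesis using query_prog_empty[of ?w l K x1 x2 J] by (metis (no_types, lifting))
  next
    case False
    then have lay: "layout l K N J ?w start active vert cand lo hi" using layout_words assms by simp
    have "contents = (layout.words l K N J start active vert cand, layout.reals N lo hi)"
      by (simp add: contents_def layout.words_def[OF lay] layout.reals_def[OF lay] layout.W_def[OF lay]
          layout.field_def[OF lay])
    then show ?thesis
      using layout.query_prog_correct[OF lay, of x1 x2] lists_all_cycles[OF lay, of x1 x2]
      by (metis (no_types, lifting))
  qed
  show "x < 2 ^ ?w" if x: "x \<in> set (fst contents)"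
  proof -
    have "0 < N" using x by (cases "N = 0") (simp_all add: contents_def table_def)
    then have lay: "layout l K N J ?w start active vert cand lo hi" using layout_words assms by simp
    show ?thesis
      using layout.words_word[OF lay, of x] x
      by (simp add: contents_def layout.words_def[OF lay] layout.W_def[OF lay] layout.field_def[OF lay])
  qed
qed

end

text \<open>Each of the three searches takes at most \<open>(cost + 24) * Suc J\<close> steps, where
  \<open>cost\<close> is that of its test; this is the origin of 72.\<close>

lemma query_delay_le:
  "query_delay l K J \<le> (cost (load_output l) + 2 * l + 72 + 2 * cost (inner_test l K) + cost (outer_test l K) + 60) * Suc J"
  by (simp add: query_delay_def find_time_def algebra_simps)

theorem theorem8:
  fixes l :: nat
  assumes "l \<ge> 2"
  shows "\<exists>c build P delay.
    range_listing_structure (cycle_graph (2 * l)) c build P delay \<and>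
    soft_O (\<lambda>I. memory_size (build I)) (\<lambda>(G, A). card (occurrences (path_graph l) G)) \<and>
    soft_O delay (\<lambda>I. 1)"
proof -
  \<comment> \<open>The number of candidates is fixed outside any graph because a single query
    program has to serve all inputs; only the memory and the delay vary with the graph.\<close>
  define K where "K = rep_bound (l - 1) (l - 1)"
  define build where "build = (\<lambda>(G, A). input_graph.contents l G A)"
  define delay where "delay = (\<lambda>(G, A). query_delay l K (input_graph.J l G A))"
  define d where "d = cost (load_output l) + 2 * l + 72 + 2 * cost (inner_test l K) + cost (outer_test l K) + 60"
  have input: "input_graph l G" "verts G = {..<card (verts G)}" "input_graph.K l = K"
    if "(G, A) \<in> attr_graphs" for G and A :: "nat \<Rightarrow> real"
  proof -
    show *: "input_graph l G" using assms that by unfold_locales (auto simp: attr_graphs_def)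
    show "verts G = {..<card (verts G)}" using that by (simp add: attr_graphs_def)
    show "input_graph.K l = K" using input_graph.K_def[OF *] by (simp add: K_def)
  qed
  have "range_listing_structure (cycle_graph (2 * l)) (word_factor l) build (query_prog l K) delay"
    unfolding range_listing_structure_def
  proof (intro ballI conjI allI)
    fix I assume I: "I \<in> attr_graphs"
    obtain G A where eq: "I = (G, A)" by force
    note query = input_graph.query_contents[OF input(1,2)[OF I[unfolded eq]], where A = A,
      unfolded input(3)[OF I[unfolded eq]]]
    show "x < 2 ^ word_length (word_factor l) I" if "x \<in> set (fst (build I))" for x
      using that query(2) by (simp add: build_def eq)
    fix M x1 x2 assume "M \<in> reachable (word_length (word_factor l) I) (query_prog l K) (build I)"
    moreover have "\<exists>tr s. exec (word_length (word_factor l) I) (query_prog l K) (query_state (build I) y1 y2) tr s \<and>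
        (mem s, rmem s) = build I" for y1 y2
      unfolding eq build_def case_prod_conv using query(1)[of y1 y2] by blast
    ultimately have "M = build I" by (rule reachable_readonly[rotated])
    then show "\<exists>tr s. exec (word_length (word_factor l) I) (query_prog l K) (query_state M x1 x2) tr s \<and>
      lists_occurrences (cycle_graph (2 * l)) (range_graph I x1 x2) (outputs tr) \<and> has_delay tr (delay I)"
      unfolding eq build_def delay_def case_prod_conv using query(1)[of x1 x2] by blast
  qed
  moreover have "soft_O (\<lambda>I. memory_size (build I)) (\<lambda>(G, A). card (occurrences (path_graph l) G))"
    unfolding soft_O_def
  proof (intro exI ballI)
    fix I assume I: "I \<in> attr_graphs"
    obtain G A where eq: "I = (G, A)" by force
    show "real (memory_size (build I)) \<le> real (9 + l + (l + 2) * Suc K) *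
      real (case I of (G, A) \<Rightarrow> card (occurrences (path_graph l) G)) * log 2 (real (num_verts I) + 2) ^ 1"
      using input_graph.contents_size[OF input(1)[OF I[unfolded eq]], of A] input(3)[OF I[unfolded eq]]
      by (simp add: eq build_def num_verts_def)
  qed
  moreover have "soft_O delay (\<lambda>I. 1)"
    unfolding soft_O_def
  proof (intro exI ballI)
    fix I assume I: "I \<in> attr_graphs"
    obtain G A where eq: "I = (G, A)" by force
    let ?L = "log 2 (real (card (verts G)) + 2)"
    note g = input(1)[OF I[unfolded eq]]
    have "real (delay I) \<le> real (d * Suc (input_graph.J l G A))"
      using query_delay_le by (intro of_nat_mono) (simp add: eq delay_def d_def)
    also have "\<dots> = real d * (1 + real (input_graph.J l G A))" by (simp add: distrib_left)
    also have "\<dots> \<le> real d * (?L + real (l + 2) * ?L)"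
      using input_graph.J_log[OF g] by (intro mult_left_mono add_mono) auto
    finally show "real (delay I) \<le> (real d * real (l + 3)) * real 1 * log 2 (real (num_verts I) + 2) ^ 1"
      by (simp add: eq num_verts_def algebra_simps)
  qed
  ultimately show ?thesis by blast
qed

end
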